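(* Let $b_1,\dots,b_{n+1} \in \mathbb{R}^m$ be an obtuse superbasis of an $n$-dimensional lattice, let $B = (b_1\;\cdots\;b_{n+1})$, let $q_{ij} = b_i \cdot b_j$, and let $p \in \mathbb{R}^{n+1}$. Put $s_i = -2\sum_{j=1}^{n+1} q_{ij} p_j$ for $i = 1,\dots,n+1$. Let $G$ be the undirected flow network with vertices $v_0,\dots,v_{n+2}$, source $v_0$, sink $v_{n+2}$, and symmetric nonnegative edge weights $$w_{ij} = w_{ji} = -q_{ij} \quad (1 \le i \neq j \leq n+1), \qquad w_{i,n+2} = w_{n+2,i} = \max(s_i,0), \quad w_{0,i} = w_{i,0} = \max(-s_i,0) \quad (1 \leq i \leq n+1),$$ and $w_{0,n+2} = w_{n+2,0} = 0$. For a cut $(C,\bar C)$ of $G$ let $t \in \{0,1\}^{n+1}$ be given by $t_i = 1$ if $v_i \in C$ and $t_i = 0$ if $v_i \in \bar C$, for $i=1,\dots,n+1$. Then $(C,\bar C)$ is a minimum cut of $G$ if and only if $t$ minimises $\|B(p - t)\|^2$ over $\{0,1\}^{n+1}$. Consequently, given the numbers $q_{ij}$ and the vector $p$, a minimiser of $\|B(p-t)\|^2$ over $t \in \{0,1\}^{n+1}$ can be computed in $O(n^3)$ operations.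
   Context: An $n$-dimensional lattice $\Lambda \subset \mathbb{R}^m$ ($m \ge n$) is the set of all integer linear combinations of $n$ linearly independent vectors (a basis) of $\mathbb{R}^m$. An obtuse superbasis of $\Lambda$ is a list of $n+1$ vectors $b_1,\dots,b_{n+1}$ such that $b_1,\dots,b_n$ is a basis of $\Lambda$, $b_1 + \dots + b_{n+1} = \mathbf{0}$, and $b_i \cdot b_j \leq 0$ for all $i \neq j$. $\|\cdot\|$ is the Euclidean norm. A cut of the flow network is a partition of the vertex set into $C$ and its complement $\bar C$ with the source $v_0 \in C$ and the sink $v_{n+2} \in \bar C$; its weight is $W(C,\bar C) = \sum_{v_i \in C}\sum_{v_j \in \bar C} w_{ij}$. A minimum cut is a cut of minimum weight. It is a known fact that a minimum cut in an undirected flow network on $N$ vertices with nonnegative edge weights can be computed in $O(N^3)$ arithmetic operations. Operations are exact real arithmetic operations and comparisons at unit cost. *)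

theory Defs
  imports "Jordan_Normal_Form.VS_Connect" "HOL-Library.Landau_Symbols"
begin

section \<open>Lattices and obtuse superbases\<close>

text \<open>Vectors, lists and the Gram numbers are indexed from 0: what is usually written
  \<open>b\<^sub>i\<close>, \<open>p\<^sub>i\<close>, \<open>q\<^sub>i\<^sub>j\<close> with \<open>1 \<le> i, j \<le> n + 1\<close> is \<open>b ! (i - 1)\<close>, \<open>p $ (i - 1)\<close>,
  \<open>gram b (i - 1) (j - 1)\<close>. Only the vertices of the network keep the numbering
  \<open>0, \<dots>, n + 2\<close>, so vertex \<open>Suc i\<close> belongs to \<open>b ! i\<close>.\<close>

definition lattice_basis :: "nat \<Rightarrow> real vec list \<Rightarrow> real vec set \<Rightarrow> bool" where
  "lattice_basis m bs \<Lambda> \<longleftrightarrow>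
     set bs \<subseteq> carrier_vec m \<and> distinct bs \<and>
     \<not> module.lin_dep class_ring (module_vec TYPE(real) m) (set bs) \<and>
     \<Lambda> = vec_module.lattice_of m bs"

definition is_lattice :: "nat \<Rightarrow> nat \<Rightarrow> real vec set \<Rightarrow> bool" where
  "is_lattice m n \<Lambda> \<longleftrightarrow> (\<exists>bs. length bs = n \<and> lattice_basis m bs \<Lambda>)"

definition obtuse_superbasis :: "nat \<Rightarrow> nat \<Rightarrow> real vec set \<Rightarrow> real vec list \<Rightarrow> bool" where
  "obtuse_superbasis m n \<Lambda> b \<longleftrightarrow>
     length b = n + 1 \<and> set b \<subseteq> carrier_vec m \<and>
     lattice_basis m (take n b) \<Lambda> \<and>
     finsum_vec TYPE(real) m (\<lambda>i. b ! i) {..n} = 0\<^sub>v m \<and>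
     (\<forall>i\<le>n. \<forall>j\<le>n. i \<noteq> j \<longrightarrow> b ! i \<bullet> b ! j \<le> 0)"

definition gram :: "real vec list \<Rightarrow> nat \<Rightarrow> nat \<Rightarrow> real" where
  "gram b i j = b ! i \<bullet> b ! j"

definition euclidean_norm :: "real vec \<Rightarrow> real" where
  "euclidean_norm v = sqrt (v \<bullet> v)"

definition binary_vecs :: "nat \<Rightarrow> real vec set" where
  "binary_vecs N = {t \<in> carrier_vec N. \<forall>i<N. t $ i \<in> {0, 1}}"

definition minimises_dist :: "real mat \<Rightarrow> real vec \<Rightarrow> real vec \<Rightarrow> bool" where
  "minimises_dist B p t \<longleftrightarrow>
     is_arg_min (\<lambda>t. (euclidean_norm (B *\<^sub>v (p - t)))\<^sup>2) (\<lambda>t. t \<in> binary_vecs (dim_col B)) t"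


section \<open>Undirected flow networks and cuts\<close>

definition undirected_flow_network ::
    "'v set \<Rightarrow> ('v \<Rightarrow> 'v \<Rightarrow> real) \<Rightarrow> 'v \<Rightarrow> 'v \<Rightarrow> bool" where
  "undirected_flow_network V w src snk \<longleftrightarrow>
     finite V \<and> src \<in> V \<and> snk \<in> V \<and> src \<noteq> snk \<and>
     (\<forall>u\<in>V. \<forall>v\<in>V. w u v = w v u \<and> 0 \<le> w u v)"

text \<open>A cut is represented by its source side \<open>C\<close>; the other side is \<open>V - C\<close>.\<close>

definition is_cut :: "'v set \<Rightarrow> 'v \<Rightarrow> 'v \<Rightarrow> 'v set \<Rightarrow> bool" where
  "is_cut V src snk C \<longleftrightarrow> C \<subseteq> V \<and> src \<in> C \<and> snk \<in> V - C"

definition cut_weight :: "'v set \<Rightarrow> ('v \<Rightarrow> 'v \<Rightarrow> real) \<Rightarrow> 'v set \<Rightarrow> real" where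
  "cut_weight V w C = (\<Sum>u\<in>C. \<Sum>v\<in>V - C. w u v)"

definition is_min_cut :: "'v set \<Rightarrow> ('v \<Rightarrow> 'v \<Rightarrow> real) \<Rightarrow> 'v \<Rightarrow> 'v \<Rightarrow> 'v set \<Rightarrow> bool" where
  "is_min_cut V w src snk C \<longleftrightarrow> is_arg_min (cut_weight V w) (is_cut V src snk) C"

definition terminal_weight :: "nat \<Rightarrow> (nat \<Rightarrow> nat \<Rightarrow> real) \<Rightarrow> real vec \<Rightarrow> nat \<Rightarrow> real" where
  "terminal_weight n q p i = - 2 * (\<Sum>j\<le>n. q i j * p $ j)"

definition network_weight ::
    "nat \<Rightarrow> (nat \<Rightarrow> nat \<Rightarrow> real) \<Rightarrow> real vec \<Rightarrow> nat \<Rightarrow> nat \<Rightarrow> real" where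
  "network_weight n q p u v =
     (let s = terminal_weight n q p; inner = {1..n + 1} in
      if u \<in> inner \<and> v \<in> inner \<and> u \<noteq> v then - q (u - 1) (v - 1)
      else if u \<in> inner \<and> v = n + 2 then max (s (u - 1)) 0
      else if u = n + 2 \<and> v \<in> inner then max (s (v - 1)) 0
      else if u = 0 \<and> v \<in> inner then max (- s (v - 1)) 0
      else if u \<in> inner \<and> v = 0 then max (- s (u - 1)) 0
      else 0)"

definition cut_vec :: "nat \<Rightarrow> nat set \<Rightarrow> real vec" where
  "cut_vec n C = vec (n + 1) (\<lambda>i. if Suc i \<in> C then 1 else 0)"


section \<open>A real random access machine\<close>

text \<open>The machine model is a uniform one: a program is a finite text of a while-language which
  has to work for every input size. It operates on arrays of natural numbers (used for
  indices and counters) and on arrays of real numbers with exact arithmetic. Arrays are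
  addressed by a name and a list of index values, scalars being arrays with the empty list of
  indices. Reals can influence a computation only through comparisons; there is no
  conversion from reals to natural numbers.

  The cost of a run counts every arithmetic operation and comparison, on reals as well as on
  natural numbers, and also every constant, memory access, logical connective, assignment,
  branching and loop test, at unit cost each. So it bounds from above the number of real
  arithmetic operations and comparisons.\<close>

datatype nexp =
    NConst nat
  | NLoad string "nexp list"
  | NAdd nexp nexp
  | NSub nexp nexp

datatype rexp =
    RConst int
  | RLoad string "nexp list"
  | RAdd rexp rexp
  | RSub rexp rexp
  | RMul rexp rexp
  | RDiv rexp rexp

datatype bexp =
    NLess nexp nexp
  | RLess rexp rexp
  | BNot bexp
  | BAnd bexp bexp

datatype com =
    Skip
  | NStore string "nexp list" nexp
  | RStore string "nexp list" rexp
  | Seq com com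
  | Cond bexp com com
  | While bexp com

record store =
  nats :: "string \<Rightarrow> nat list \<Rightarrow> nat"
  reals :: "string \<Rightarrow> nat list \<Rightarrow> real"

fun nval :: "nexp \<Rightarrow> store \<Rightarrow> nat" where
  "nval (NConst k) s = k"
| "nval (NLoad x es) s = nats s x (map (\<lambda>e. nval e s) es)"
| "nval (NAdd a b) s = nval a s + nval b s"
| "nval (NSub a b) s = nval a s - nval b s"

fun rval :: "rexp \<Rightarrow> store \<Rightarrow> real" where
  "rval (RConst k) s = of_int k"
| "rval (RLoad x es) s = reals s x (map (\<lambda>e. nval e s) es)"
| "rval (RAdd a b) s = rval a s + rval b s"
| "rval (RSub a b) s = rval a s - rval b s"
| "rval (RMul a b) s = rval a s * rval b s"
| "rval (RDiv a b) s = rval a s / rval b s"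

fun bval :: "bexp \<Rightarrow> store \<Rightarrow> bool" where
  "bval (NLess a b) s \<longleftrightarrow> nval a s < nval b s"
| "bval (RLess a b) s \<longleftrightarrow> rval a s < rval b s"
| "bval (BNot a) s \<longleftrightarrow> \<not> bval a s"
| "bval (BAnd a b) s \<longleftrightarrow> bval a s \<and> bval b s"

fun ncost :: "nexp \<Rightarrow> nat" where
  "ncost (NConst k) = 1"
| "ncost (NLoad x es) = 1 + sum_list (map ncost es)"
| "ncost (NAdd a b) = 1 + ncost a + ncost b"
| "ncost (NSub a b) = 1 + ncost a + ncost b"

fun rcost :: "rexp \<Rightarrow> nat" where
  "rcost (RConst k) = 1"
| "rcost (RLoad x es) = 1 + sum_list (map ncost es)"
| "rcost (RAdd a b) = 1 + rcost a + rcost b"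
| "rcost (RSub a b) = 1 + rcost a + rcost b"
| "rcost (RMul a b) = 1 + rcost a + rcost b"
| "rcost (RDiv a b) = 1 + rcost a + rcost b"

fun bcost :: "bexp \<Rightarrow> nat" where
  "bcost (NLess a b) = 1 + ncost a + ncost b"
| "bcost (RLess a b) = 1 + rcost a + rcost b"
| "bcost (BNot a) = 1 + bcost a"
| "bcost (BAnd a b) = 1 + bcost a + bcost b"

definition nstore :: "string \<Rightarrow> nat list \<Rightarrow> nat \<Rightarrow> store \<Rightarrow> store" where
  "nstore x is k s = s\<lparr>nats := (nats s)(x := (nats s x)(is := k))\<rparr>"

definition rstore :: "string \<Rightarrow> nat list \<Rightarrow> real \<Rightarrow> store \<Rightarrow> store" where
  "rstore x is r s = s\<lparr>reals := (reals s)(x := (reals s x)(is := r))\<rparr>"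

text \<open>\<open>exec c s k s'\<close>: started in \<open>s\<close>, the program \<open>c\<close> terminates in \<open>s'\<close> after \<open>k\<close> operations.\<close>

inductive exec :: "com \<Rightarrow> store \<Rightarrow> nat \<Rightarrow> store \<Rightarrow> bool" where
  Skip: "exec Skip s 0 s"
| NStore: "exec (NStore x es e) s (1 + sum_list (map ncost es) + ncost e)
     (nstore x (map (\<lambda>e. nval e s) es) (nval e s) s)"
| RStore: "exec (RStore x es e) s (1 + sum_list (map ncost es) + rcost e)
     (rstore x (map (\<lambda>e. nval e s) es) (rval e s) s)"
| Seq: "exec c1 s1 k1 s2 \<Longrightarrow> exec c2 s2 k2 s3 \<Longrightarrow> exec (Seq c1 c2) s1 (k1 + k2) s3"
| CondTrue: "bval b s \<Longrightarrow> exec c1 s k s' \<Longrightarrow> exec (Cond b c1 c2) s (1 + bcost b + k) s'"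
| CondFalse: "\<not> bval b s \<Longrightarrow> exec c2 s k s' \<Longrightarrow> exec (Cond b c1 c2) s (1 + bcost b + k) s'"
| WhileFalse: "\<not> bval b s \<Longrightarrow> exec (While b c) s (1 + bcost b) s"
| WhileTrue: "bval b s1 \<Longrightarrow> exec c s1 k1 s2 \<Longrightarrow> exec (While b c) s2 k2 s3 \<Longrightarrow>
     exec (While b c) s1 (1 + bcost b + k1 + k2) s3"

inductive_cases exec_elims:
  "exec Skip s k s'" "exec (NStore x es e) s k s'" "exec (RStore x es e) s k s'"
  "exec (Seq c1 c2) s k s'" "exec (Cond b c1 c2) s k s'"

inductive_cases exec_WhileE: "exec (While b c) s k s'"

lemma exec_deterministic:
  "exec c s k s' \<Longrightarrow> exec c s k' s'' \<Longrightarrow> k' = k \<and> s'' = s'"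
proof (induction arbitrary: k' s'' rule: exec.induct)
  case (WhileFalse b s c)
  then show ?case by (auto elim: exec_WhileE)
next
  case (WhileTrue b s1 c k1 s2 k2 s3)
  from WhileTrue.prems show ?case
    by (rule exec_WhileE) (use WhileTrue.hyps(1) WhileTrue.IH in fastforce)+
qed (erule exec_elims; fastforce)+

text \<open>All cells of the store not mentioned here are arbitrary.\<close>

definition input_stored :: "nat \<Rightarrow> (nat \<Rightarrow> nat \<Rightarrow> real) \<Rightarrow> real vec \<Rightarrow> store \<Rightarrow> bool" where
  "input_stored n q p s \<longleftrightarrow>
     nats s ''n'' [] = n \<and>
     (\<forall>i\<le>n. \<forall>j\<le>n. reals s ''q'' [i, j] = q i j) \<and>
     (\<forall>i\<le>n. reals s ''p'' [i] = p $ i)"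

definition output_vec :: "nat \<Rightarrow> store \<Rightarrow> real vec" where
  "output_vec n s = vec (n + 1) (\<lambda>i. reals s ''t'' [i])"

end

(*
  With x the indicator vector of T and zero row sums of the Gram matrix, both |B(p - x)|^2 and the
  weight of the cut with inner vertices T equal, up to a constant, the sum of q over T x T minus
  the sum over T of the excess e = 2 q p. This gives the equivalence.

  For the running time, this set function is minimised by highest-label push-relabel on the n + 1
  inner vertices, the terminals being absorbed into signed excesses. A vertex is abandoned as soon
  as its label reaches n + 2, so no flow is ever returned to the source. When no excess is left
  elsewhere, one of the levels 0, ..., n + 1 carries none of the n + 1 vertices; no residual arc
  jumps down over it, so the vertices above it form a minimiser. Each loop iteration takes constant
  time, and a potential of order n^3 decreases with every iteration.
*)
theory Submission
  imports Defs
begin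

section \<open>Running loop-free programs\<close>

text \<open>Why highest-label order gives a cubic bound: excess is pushed only to labels below the
  scanned level, so it never reappears behind the scan, and between relabellings the scan only moves
  forward through pairs of level and vertex. A non-saturating push empties its vertex and moves the
  scan on, so each visited pair has at most one. There are O(n^2) relabellings, each lifting the
  scan by one level, hence O(n^2) level visits and O(n^3) pairs. Every other step advances a current
  arc, at most n + 1 times per relabelling of its vertex.

  Abandoning vertices is sound because only a cut is wanted: optimality needs just the sign of the
  excess on each side of the empty level, not a completed flow.

  To make the cost accounting trivial, nested loops are flattened into single loops with loop-free
  bodies, and a relabelling adds exactly one to a label instead of searching the neighbours for the
  smallest admissible value.\<close>

definition runs_within :: "com \<Rightarrow> store \<Rightarrow> nat \<Rightarrow> (store \<Rightarrow> bool) \<Rightarrow> bool" where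
  "runs_within c s K Q \<longleftrightarrow> (\<exists>k s'. exec c s k s' \<and> k \<le> K \<and> Q s')"

fun loop_free :: "com \<Rightarrow> bool" where
  "loop_free (Seq c1 c2) \<longleftrightarrow> loop_free c1 \<and> loop_free c2"
| "loop_free (Cond b c1 c2) \<longleftrightarrow> loop_free c1 \<and> loop_free c2"
| "loop_free (While b c) \<longleftrightarrow> False"
| "loop_free _ \<longleftrightarrow> True"

text \<open>A functional semantics for loop bodies, so that the simplifier can compute the final
  store. Loops enter only through \<open>runs_within_While\<close>.\<close>

fun run :: "com \<Rightarrow> store \<Rightarrow> store" where
  "run Skip s = s"
| "run (NStore x es e) s = nstore x (map (\<lambda>e. nval e s) es) (nval e s) s"
| "run (RStore x es e) s = rstore x (map (\<lambda>e. nval e s) es) (rval e s) s"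
| "run (Seq c1 c2) s = run c2 (run c1 s)"
| "run (Cond b c1 c2) s = (if bval b s then run c1 s else run c2 s)"
| "run (While b c) s = s"

fun max_cost :: "com \<Rightarrow> nat" where
  "max_cost Skip = 0"
| "max_cost (NStore x es e) = 1 + sum_list (map ncost es) + ncost e"
| "max_cost (RStore x es e) = 1 + sum_list (map ncost es) + rcost e"
| "max_cost (Seq c1 c2) = max_cost c1 + max_cost c2"
| "max_cost (Cond b c1 c2) = 1 + bcost b + max (max_cost c1) (max_cost c2)"
| "max_cost (While b c) = 0"

lemma exec_run: "loop_free c \<Longrightarrow> \<exists>k \<le> max_cost c. exec c s k (run c s)"
proof (induction c arbitrary: s)
  case (Seq c1 c2)
  then obtain k1 k2 where "k1 \<le> max_cost c1" "exec c1 s k1 (run c1 s)"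
    "k2 \<le> max_cost c2" "exec c2 (run c1 s) k2 (run c2 (run c1 s))"
    by (metis loop_free.simps(1))
  then show ?case
    using exec.Seq by (intro exI[of _ "k1 + k2"]) auto
next
  case (Cond b c1 c2)
  then have "loop_free c1" "loop_free c2" by auto
  with Cond.IH obtain k1 k2 where "k1 \<le> max_cost c1" "exec c1 s k1 (run c1 s)"
    "k2 \<le> max_cost c2" "exec c2 s k2 (run c2 s)"
    by metis
  then show ?case
    using exec.CondTrue[of b s c1 k1 "run c1 s" c2] exec.CondFalse[of b s c2 k2 "run c2 s" c1]
    by (intro exI[of _ "1 + bcost b + (if bval b s then k1 else k2)"]) auto
next
  case Skip
  then show ?case using exec.Skip by auto
next
  case (NStore x es e)
  then show ?case using exec.NStore by fastforce
next
  case (RStore x es e)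
  then show ?case using exec.RStore by fastforce
qed simp

lemma runs_within_run:
  assumes "loop_free c" "Q (run c s)"
  shows "runs_within c s (max_cost c) Q"
  unfolding runs_within_def using exec_run[OF assms(1), of s] assms(2) by blast

lemma runs_within_Seq:
  assumes "runs_within c1 s K1 Q1" "\<And>s'. Q1 s' \<Longrightarrow> runs_within c2 s' K2 Q"
  shows "runs_within (Seq c1 c2) s (K1 + K2) Q"
  using assms unfolding runs_within_def by (meson add_mono exec.Seq)

lemma runs_within_weaken:
  assumes "runs_within c s K Q" "K \<le> K'" "\<And>s'. Q s' \<Longrightarrow> Q' s'"
  shows "runs_within c s K' Q'"
  using assms unfolding runs_within_def by (meson le_trans)

text \<open>A loop-free body has a cost bound independent of the store. A measure strictly below
  \<open>N\<close> allows at most \<open>N - 1\<close> iterations, and the remaining share of the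
  bound pays for the failing test.\<close>

lemma runs_within_While:
  assumes "loop_free c" "I s" "\<mu> s < N"
    and step: "\<And>s. I s \<Longrightarrow> bval b s \<Longrightarrow> I (run c s) \<and> \<mu> (run c s) < (\<mu> s :: nat)"
  shows "runs_within (While b c) s (N * (1 + bcost b + max_cost c)) (\<lambda>s'. I s' \<and> \<not> bval b s')"
  using \<open>I s\<close> \<open>\<mu> s < N\<close>
proof (induction N arbitrary: s)
  case (Suc N)
  show ?case
  proof (cases "bval b s")
    case True
    then have "runs_within (While b c) (run c s) (N * (1 + bcost b + max_cost c))
        (\<lambda>s'. I s' \<and> \<not> bval b s')"
      using Suc step[of s] by auto
    then obtain k s' where k: "exec (While b c) (run c s) k s'"
      "k \<le> N * (1 + bcost b + max_cost c)" "I s'" "\<not> bval b s'"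
      unfolding runs_within_def by blast
    obtain k1 where k1: "k1 \<le> max_cost c" "exec c s k1 (run c s)"
      using exec_run[OF assms(1)] by blast
    have "exec (While b c) s (1 + bcost b + k1 + k) s'"
      using True k1 k exec.WhileTrue by blast
    moreover have "1 + bcost b + k1 + k \<le> Suc N * (1 + bcost b + max_cost c)"
      using k(2) k1(1) by simp
    ultimately show ?thesis
      unfolding runs_within_def using k by blast
  next
    case False
    then show ?thesis
      unfolding runs_within_def using exec.WhileFalse[of b s c] Suc.prems
      by (intro exI[of _ "1 + bcost b"] exI[of _ s]) auto
  qed
qed auto

section \<open>Reading the store after an assignment\<close>

lemma nats_nstore [simp]:
  "nats (nstore x is k s) y js = (if x = y \<and> is = js then k else nats s y js)"
  by (auto simp: nstore_def)

lemma nats_rstore [simp]: "nats (rstore x is r s) = nats s"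
  by (simp add: rstore_def)

lemma reals_rstore [simp]:
  "reals (rstore x is r s) y js = (if x = y \<and> is = js then r else reals s y js)"
  by (auto simp: rstore_def)

lemma reals_nstore [simp]: "reals (nstore x is k s) = reals s"
  by (simp add: nstore_def)

section \<open>Quadratic form and cut weight\<close>

text \<open>With nonpositive off-diagonal entries of \<open>q\<close> this is a submodular quadratic
  pseudo-Boolean function, the kind that minimum cuts can minimise.\<close>

definition set_objective ::
    "(nat \<Rightarrow> nat \<Rightarrow> real) \<Rightarrow> (nat \<Rightarrow> real) \<Rightarrow> nat set \<Rightarrow> real" where
  "set_objective q e T = (\<Sum>i\<in>T. \<Sum>j\<in>T. q i j) - (\<Sum>i\<in>T. e i)"

definition indicator_vec :: "nat \<Rightarrow> nat set \<Rightarrow> real vec" where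
  "indicator_vec n T = vec (n + 1) (\<lambda>i. if i \<in> T then 1 else 0)"

lemma binary_vecs_eq_indicators: "binary_vecs (n + 1) = indicator_vec n ` Pow {..n}"
proof (intro equalityI subsetI)
  fix t assume t: "t \<in> binary_vecs (n + 1)"
  then have "t = indicator_vec n {i. i \<le> n \<and> t $ i = 1}"
    by (intro eq_vecI) (auto simp: binary_vecs_def indicator_vec_def)
  then show "t \<in> indicator_vec n ` Pow {..n}" by blast
qed (auto simp: indicator_vec_def binary_vecs_def)

lemma euclidean_norm_mat_of_cols:
  assumes b: "length b = N" "set b \<subseteq> carrier_vec m" and x: "x \<in> carrier_vec N"
  shows "(euclidean_norm (mat_of_cols m b *\<^sub>v x))\<^sup>2 = (\<Sum>i<N. \<Sum>j<N. x $ i * x $ j * gram b i j)"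
proof -
  have bi: "dim_vec (b ! i) = m" if "i < N" for i
    using b that nth_mem[of i b] by (metis carrier_vecD subsetD)
  have entry: "(mat_of_cols m b *\<^sub>v x) $ r = (\<Sum>i<N. (b ! i) $ r * x $ i)" if "r < m" for r
    using that b x
    by (auto simp: scalar_prod_def lessThan_atLeast0 mat_of_cols_index intro!: sum.cong)
  have "(mat_of_cols m b *\<^sub>v x) \<bullet> (mat_of_cols m b *\<^sub>v x) =
      (\<Sum>r<m. (\<Sum>i<N. (b ! i) $ r * x $ i) * (\<Sum>j<N. (b ! j) $ r * x $ j))" (is "?n = ?S")
    using entry by (simp add: scalar_prod_def lessThan_atLeast0)
  moreover have "?S \<ge> 0" by (intro sum_nonneg) simp
  ultimately have "(euclidean_norm (mat_of_cols m b *\<^sub>v x))\<^sup>2 = ?S"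
    by (simp only: euclidean_norm_def real_sqrt_pow2)
  also have "?S = (\<Sum>r<m. \<Sum>i<N. \<Sum>j<N. x $ i * x $ j * ((b ! i) $ r * (b ! j) $ r))"
    unfolding sum_product by (intro sum.cong refl) (simp add: mult_ac)
  also have "\<dots> = (\<Sum>i<N. \<Sum>r<m. \<Sum>j<N. x $ i * x $ j * ((b ! i) $ r * (b ! j) $ r))"
    by (rule sum.swap)
  also have "\<dots> = (\<Sum>i<N. \<Sum>j<N. \<Sum>r<m. x $ i * x $ j * ((b ! i) $ r * (b ! j) $ r))"
    by (intro sum.cong refl sum.swap)
  also have "\<dots> = (\<Sum>i<N. \<Sum>j<N. x $ i * x $ j * gram b i j)"
    using bi by (intro sum.cong refl)
      (simp add: gram_def scalar_prod_def lessThan_atLeast0 sum_distrib_left)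
  finally show ?thesis .
qed

lemma gram_sym: "set b \<subseteq> carrier_vec m \<Longrightarrow> i < length b \<Longrightarrow> j < length b \<Longrightarrow> gram b i j = gram b j i"
  unfolding gram_def by (metis comm_scalar_prod nth_mem subsetD)

text \<open>Take the inner product of \<open>b ! i\<close> with the relation that the superbasis
  sums to zero. This is what makes the constant vector invisible to the quadratic form.\<close>

lemma superbasis_row_sum:
  assumes "obtuse_superbasis m n \<Lambda> b" "i \<le> n"
  shows "(\<Sum>j\<le>n. gram b i j) = 0"
proof -
  have dim: "dim_vec (b ! j) = m" if "j \<le> n" for j
  proof -
    have "b ! j \<in> carrier_vec m"
      using assms(1) that nth_mem[of j b] by (auto simp: obtuse_superbasis_def)
    then show ?thesis by simp
  qed
  have "(\<Sum>j\<le>n. (b ! j) $ r) = 0" if "r < m" for r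
  proof -
    have "(\<lambda>i. b ! i) \<in> {..n} \<rightarrow> carrier_vec m" using dim by (auto intro: carrier_vecI)
    with that have "finsum_vec TYPE(real) m (\<lambda>i. b ! i) {..n} $ r = (\<Sum>j\<le>n. (b ! j) $ r)"
      by (intro index_finsum_vec) auto
    with that assms(1) show ?thesis by (simp add: obtuse_superbasis_def)
  qed
  then have zero: "(\<Sum>r<m. (b ! i) $ r * (\<Sum>j\<le>n. (b ! j) $ r)) = 0"
    by simp
  have "(\<Sum>j\<le>n. gram b i j) = (\<Sum>j\<le>n. \<Sum>r<m. (b ! i) $ r * (b ! j) $ r)"
    using dim by (simp add: gram_def scalar_prod_def lessThan_atLeast0)
  also have "\<dots> = (\<Sum>r<m. \<Sum>j\<le>n. (b ! i) $ r * (b ! j) $ r)" by (rule sum.swap)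
  finally show ?thesis using zero by (simp add: sum_distrib_left)
qed

text \<open>Expanding the quadratic form at \<open>p - x\<close>, symmetry of the Gram matrix merges
  the two mixed terms; this is the origin of the factor 2 in \<open>terminal_weight\<close>.\<close>

lemma dist_indicator_vec:
  assumes b: "length b = n + 1" "set b \<subseteq> carrier_vec m" and p: "p \<in> carrier_vec (n + 1)"
    and T: "T \<subseteq> {..n}"
  shows "(euclidean_norm (mat_of_cols m b *\<^sub>v (p - indicator_vec n T)))\<^sup>2 =
    (\<Sum>i\<le>n. \<Sum>j\<le>n. p $ i * p $ j * gram b i j) +
    set_objective (gram b) (\<lambda>i. - terminal_weight n (gram b) p i) T"
proof -
  let ?q = "gram b"
  let ?c = "\<lambda>i. if i \<in> T then 1 else 0 :: real"
  have restrict: "(\<Sum>i\<le>n. ?c i * f i) = (\<Sum>i\<in>T. f i)" for f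
  proof -
    have "(\<Sum>i\<le>n. ?c i * f i) = (\<Sum>i\<le>n. if i \<in> T then f i else 0)"
      by (intro sum.cong) auto
    also have "\<dots> = (\<Sum>i\<in>{..n} \<inter> T. f i)"
      by (simp add: sum.inter_restrict)
    also have "{..n} \<inter> T = T" using T by blast
    finally show ?thesis .
  qed
  have "(euclidean_norm (mat_of_cols m b *\<^sub>v (p - indicator_vec n T)))\<^sup>2 =
      (\<Sum>i\<le>n. \<Sum>j\<le>n. (p $ i - ?c i) * (p $ j - ?c j) * ?q i j)"
    using p by (subst euclidean_norm_mat_of_cols[OF b])
      (auto simp: indicator_vec_def lessThan_Suc_atMost intro!: sum.cong)
  also have "\<dots> = (\<Sum>i\<le>n. \<Sum>j\<le>n. p $ i * p $ j * ?q i j) + (\<Sum>i\<le>n. \<Sum>j\<le>n. ?c i * (?c j * ?q i j))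
      - (\<Sum>i\<le>n. \<Sum>j\<le>n. ?c i * (?q i j * p $ j)) - (\<Sum>i\<le>n. \<Sum>j\<le>n. ?c j * (?q i j * p $ i))"
    unfolding sum.distrib[symmetric] sum_subtractf[symmetric]
    by (intro sum.cong refl) (simp add: algebra_simps)
  also have "(\<Sum>i\<le>n. \<Sum>j\<le>n. ?c j * (?q i j * p $ i)) = (\<Sum>j\<le>n. \<Sum>i\<le>n. ?c j * (?q i j * p $ i))"
    by (rule sum.swap)
  also have "\<dots> = (\<Sum>j\<le>n. \<Sum>i\<le>n. ?c j * (?q j i * p $ i))"
    using gram_sym[OF b(2)] b(1) by (intro sum.cong refl) simp
  also have "(\<Sum>i\<le>n. \<Sum>j\<le>n. ?c i * (?c j * ?q i j)) = (\<Sum>i\<in>T. \<Sum>j\<in>T. ?q i j)"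
    by (simp only: sum_distrib_left[symmetric] restrict)
  also have "(\<Sum>i\<le>n. \<Sum>j\<le>n. ?c i * (?q i j * p $ j)) = (\<Sum>i\<in>T. \<Sum>j\<le>n. ?q i j * p $ j)"
    by (simp only: sum_distrib_left[symmetric] restrict)
  finally show ?thesis
    by (simp add: set_objective_def terminal_weight_def sum_distrib_left[symmetric] sum_negf)
qed

text \<open>Two exchanges remove the dependence on the complement \<open>U\<close> of
  \<open>T\<close>. Zero row sums turn the weight between \<open>T\<close> and \<open>U\<close> into
  a sum over \<open>T\<close> alone, and \<open>max s 0 = max (- s) 0 + s\<close> trades the cut
  sink arcs of \<open>T\<close> for source arcs, so that all source arcs together form the
  constant.\<close>

lemma network_cut_weight:
  assumes C: "is_cut {0..n + 2} 0 (n + 2) C"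
    and row: "\<And>i. i \<le> n \<Longrightarrow> (\<Sum>j\<le>n. q i j) = 0"
  shows "cut_weight {0..n + 2} (network_weight n q p) C =
    (\<Sum>i\<le>n. max (- terminal_weight n q p i) 0) +
    set_objective q (\<lambda>i. - terminal_weight n q p i) {i. Suc i \<in> C}"
proof -
  let ?w = "network_weight n q p" and ?s = "terminal_weight n q p"
  define T where "T = {i. Suc i \<in> C}"
  define U where "U = {..n} - T"
  have T: "T \<subseteq> {..n}"
  proof
    fix i assume "i \<in> T"
    then have "Suc i \<in> C" by (simp add: T_def)
    then have "Suc i \<le> n + 2" "Suc i \<noteq> n + 2" using C by (auto simp: is_cut_def)
    then show "i \<in> {..n}" by auto
  qed
  then have fin: "finite T" "finite U" using finite_subset by (auto simp: U_def)
  have C_eq: "C = insert 0 (Suc ` T)"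
  proof (intro Set.set_eqI)
    fix x
    show "x \<in> C \<longleftrightarrow> x \<in> insert 0 (Suc ` T)"
      using C by (cases x) (auto simp: is_cut_def T_def)
  qed
  have "{0..n + 2} = insert 0 (insert (n + 2) (Suc ` {..n}))"
  proof (intro Set.set_eqI)
    fix x
    show "x \<in> {0..n + 2} \<longleftrightarrow> x \<in> insert 0 (insert (n + 2) (Suc ` {..n}))"
      by (cases x) auto
  qed
  then have D_eq: "{0..n + 2} - C = insert (n + 2) (Suc ` U)"
    using C T by (auto simp: C_eq U_def is_cut_def)
  have disj: "i \<noteq> j" if "i \<in> T" "j \<in> U" for i j using that by (auto simp: U_def)
  have inT: "Suc i \<in> {1..n + 1}" if "i \<in> T \<or> i \<in> U" for i using that T by (auto simp: U_def)
  have source: "(\<Sum>v\<in>insert (n + 2) (Suc ` U). ?w 0 v) = (\<Sum>j\<in>U. max (- ?s j) 0)"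
  proof -
    have "n + 2 \<notin> Suc ` U" by (auto simp: U_def)
    then show ?thesis
      using fin inT by (auto simp: sum.reindex network_weight_def Let_def intro!: sum.cong)
  qed
  have inner: "(\<Sum>v\<in>insert (n + 2) (Suc ` U). ?w (Suc i) v) = max (?s i) 0 - (\<Sum>j\<in>U. q i j)"
    if "i \<in> T" for i
  proof -
    have "n + 2 \<notin> Suc ` U" by (auto simp: U_def)
    moreover have "?w (Suc i) (n + 2) = max (?s i) 0"
      using inT that by (auto simp: network_weight_def Let_def)
    moreover have "?w (Suc i) (Suc j) = - q i j" if "j \<in> U" for j
      using inT that \<open>i \<in> T\<close> disj by (auto simp: network_weight_def Let_def)
    ultimately show ?thesis
      using fin by (simp add: sum.reindex sum_negf)
  qed
  have split: "(\<Sum>i\<le>n. f i) = (\<Sum>i\<in>T. f i) + (\<Sum>i\<in>U. f i)" for f :: "nat \<Rightarrow> real"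
    using T sum.subset_diff[of T "{..n}" f] by (simp add: U_def)
  have row': "- (\<Sum>j\<in>U. q i j) = (\<Sum>j\<in>T. q i j)" if "i \<in> T" for i
    using row[of i] split[of "q i"] T that by auto
  have "cut_weight {0..n + 2} ?w C =
      (\<Sum>u\<in>C. \<Sum>v\<in>insert (n + 2) (Suc ` U). ?w u v)"
    by (simp only: cut_weight_def D_eq)
  also have "\<dots> = (\<Sum>j\<in>U. max (- ?s j) 0) + (\<Sum>i\<in>T. \<Sum>v\<in>insert (n + 2) (Suc ` U). ?w (Suc i) v)"
    unfolding C_eq using fin source by (simp add: sum.reindex)
  also have "\<dots> = (\<Sum>j\<in>U. max (- ?s j) 0) + (\<Sum>i\<in>T. max (- ?s i) 0 + ?s i + (\<Sum>j\<in>T. q i j))"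
  proof -
    have "max (?s i) 0 - (\<Sum>j\<in>U. q i j) = max (- ?s i) 0 + ?s i + (\<Sum>j\<in>T. q i j)"
      if "i \<in> T" for i
      using row'[OF that] by (simp add: max_def)
    then show ?thesis using inner by simp
  qed
  also have "\<dots> = (\<Sum>i\<le>n. max (- ?s i) 0) + set_objective q (\<lambda>i. - ?s i) T"
    by (simp add: split sum.distrib set_objective_def sum_negf)
  finally show ?thesis by (simp add: T_def)
qed

section \<open>Minimum cuts and closest binary vectors\<close>

lemma minimises_dist_indicator:
  assumes b: "length b = n + 1" "set b \<subseteq> carrier_vec m" and p: "p \<in> carrier_vec (n + 1)"
    and T: "T \<subseteq> {..n}"
  shows "minimises_dist (mat_of_cols m b) p (indicator_vec n T) \<longleftrightarrow>
    (\<forall>T'\<subseteq>{..n}. set_objective (gram b) (\<lambda>i. - terminal_weight n (gram b) p i) T \<le>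
       set_objective (gram b) (\<lambda>i. - terminal_weight n (gram b) p i) T')"
proof -
  have dim: "dim_col (mat_of_cols m b) = n + 1" using b by simp
  show ?thesis
    unfolding minimises_dist_def is_arg_min_def dim binary_vecs_eq_indicators
    using dist_indicator_vec[OF b p] T by (auto simp: not_less)
qed

lemma network_undirected:
  assumes "obtuse_superbasis m n \<Lambda> b"
  shows "undirected_flow_network {0..n + 2} (network_weight n (gram b) p) 0 (n + 2)"
proof -
  have sym: "gram b i j = gram b j i" if "i \<le> n" "j \<le> n" for i j
    using assms that gram_sym[of b m i j] by (simp add: obtuse_superbasis_def)
  have neg: "gram b i j \<le> 0" if "i \<le> n" "j \<le> n" "i \<noteq> j" for i j
    using assms that by (simp add: obtuse_superbasis_def gram_def)
  show ?thesis
    unfolding undirected_flow_network_def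
    using sym neg by (auto simp: network_weight_def Let_def)
qed

lemma min_cut_iff_minimises_dist:
  assumes sb: "obtuse_superbasis m n \<Lambda> b" and p: "p \<in> carrier_vec (n + 1)"
    and C: "is_cut {0..n + 2} 0 (n + 2) C"
  shows "is_min_cut {0..n + 2} (network_weight n (gram b) p) 0 (n + 2) C \<longleftrightarrow>
    minimises_dist (mat_of_cols m b) p (cut_vec n C)"
proof -
  let ?inner = "\<lambda>C. {i. Suc i \<in> C}"
  let ?f = "set_objective (gram b) (\<lambda>i. - terminal_weight n (gram b) p i)"
  have b: "length b = n + 1" "set b \<subseteq> carrier_vec m"
    using sb by (auto simp: obtuse_superbasis_def)
  have sub: "?inner C \<subseteq> {..n}" if "is_cut {0..n + 2} 0 (n + 2) C" for C
  proof
    fix i assume "i \<in> ?inner C"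
    then have "Suc i \<le> n + 2" "Suc i \<noteq> n + 2" using that by (auto simp: is_cut_def)
    then show "i \<in> {..n}" by auto
  qed
  \<comment> \<open>Every set of inner vertices is the source side of a cut, so minimality over cuts
    is minimality over all subsets.\<close>
  have surj: "\<exists>C. is_cut {0..n + 2} 0 (n + 2) C \<and> ?inner C = T" if "T \<subseteq> {..n}" for T
    using that by (intro exI[of _ "insert 0 (Suc ` T)"]) (fastforce simp: is_cut_def)
  have weight: "cut_weight {0..n + 2} (network_weight n (gram b) p) C =
      (\<Sum>i\<le>n. max (- terminal_weight n (gram b) p i) 0) + ?f (?inner C)"
    if "is_cut {0..n + 2} 0 (n + 2) C" for C
    using network_cut_weight[OF that superbasis_row_sum[OF sb]] by simp
  have "is_min_cut {0..n + 2} (network_weight n (gram b) p) 0 (n + 2) C \<longleftrightarrow>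
      (\<forall>C'. is_cut {0..n + 2} 0 (n + 2) C' \<longrightarrow> ?f (?inner C) \<le> ?f (?inner C'))"
    unfolding is_min_cut_def is_arg_min_def using C weight by (auto simp: not_less)
  also have "\<dots> \<longleftrightarrow> (\<forall>T'\<subseteq>{..n}. ?f (?inner C) \<le> ?f T')"
  proof (intro iffI allI impI)
    fix T' assume le: "\<forall>C'. is_cut {0..n + 2} 0 (n + 2) C' \<longrightarrow> ?f (?inner C) \<le> ?f (?inner C')"
      and "T' \<subseteq> {..n}"
    then obtain C' where "is_cut {0..n + 2} 0 (n + 2) C'" "?inner C' = T'" using surj by blast
    with le show "?f (?inner C) \<le> ?f T'" by blast
  qed (use sub in blast)
  also have "\<dots> \<longleftrightarrow> minimises_dist (mat_of_cols m b) p (indicator_vec n (?inner C))"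
    using minimises_dist_indicator[OF b p sub[OF C]] by simp
  also have "indicator_vec n (?inner C) = cut_vec n C"
    by (simp add: indicator_vec_def cut_vec_def)
  finally show ?thesis .
qed

section \<open>Highest-label push-relabel\<close>

text \<open>Eliminating both terminals, vertex \<open>a\<close> starts with the signed excess \<open>e0 a\<close>, a deficit
  being residual capacity into the sink. The residual capacity of the arc from \<open>a\<close> to \<open>b\<close> is
  \<open>- q a b\<close>. Vertices whose label has reached \<open>n + 2\<close> are abandoned. The scan is at vertex \<open>i\<close>
  of label \<open>h - 1\<close>, and \<open>c a\<close> is the current arc of \<open>a\<close>.\<close>

definition preflow_inv ::
    "nat \<Rightarrow> (nat \<Rightarrow> nat \<Rightarrow> real) \<Rightarrow> (nat \<Rightarrow> real) \<Rightarrow> (nat \<Rightarrow> nat \<Rightarrow> real) \<Rightarrow> (nat \<Rightarrow> real) \<Rightarrow>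
     (nat \<Rightarrow> nat) \<Rightarrow> (nat \<Rightarrow> nat) \<Rightarrow> nat \<Rightarrow> nat \<Rightarrow> bool" where
  "preflow_inv n q0 e0 q e d c h i \<longleftrightarrow>
     (\<forall>a\<le>n. (\<Sum>b\<le>n. q a b) + e a = e0 a) \<and>
     (\<forall>a\<le>n. \<forall>b\<le>n. q a b + q b a = q0 a b + q0 b a) \<and>
     (\<forall>a\<le>n. \<forall>b\<le>n. a \<noteq> b \<longrightarrow> q a b \<le> 0) \<and>
     (\<forall>a\<le>n. \<forall>b\<le>n. q a b < 0 \<longrightarrow> d a \<le> d b + 1) \<and>
     (\<forall>a\<le>n. e a < 0 \<longrightarrow> d a = 0) \<and>
     (\<forall>a\<le>n. c a \<le> n + 1 \<and> d a \<le> n + 2) \<and>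
     (\<forall>a\<le>n. \<forall>b<c a. q a b < 0 \<longrightarrow> d a \<le> d b) \<and>
     (\<forall>a\<le>n. e a > 0 \<and> d a < n + 2 \<longrightarrow> d a + 1 < h \<or> d a + 1 = h \<and> i \<le> a) \<and>
     i \<le> n + 1"

lemma preflow_invD:
  assumes "preflow_inv n q0 e0 q e d c h i"
  shows "a \<le> n \<Longrightarrow> (\<Sum>b\<le>n. q a b) + e a = e0 a"
    and "a \<le> n \<Longrightarrow> b \<le> n \<Longrightarrow> q a b + q b a = q0 a b + q0 b a"
    and "a \<le> n \<Longrightarrow> b \<le> n \<Longrightarrow> a \<noteq> b \<Longrightarrow> q a b \<le> 0"
    and "a \<le> n \<Longrightarrow> b \<le> n \<Longrightarrow> q a b < 0 \<Longrightarrow> d a \<le> d b + 1"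
    and "a \<le> n \<Longrightarrow> e a < 0 \<Longrightarrow> d a = 0"
    and "a \<le> n \<Longrightarrow> c a \<le> n + 1"
    and "a \<le> n \<Longrightarrow> d a \<le> n + 2"
    and "a \<le> n \<Longrightarrow> b < c a \<Longrightarrow> q a b < 0 \<Longrightarrow> d a \<le> d b"
    and "a \<le> n \<Longrightarrow> 0 < e a \<Longrightarrow> d a < n + 2 \<Longrightarrow> d a + 1 < h \<or> d a + 1 = h \<and> i \<le> a"
    and "i \<le> n + 1"
  using assms by (simp_all add: preflow_inv_def)

lemma preflow_invI:
  assumes "\<And>a. a \<le> n \<Longrightarrow> (\<Sum>b\<le>n. q a b) + e a = e0 a"
    and "\<And>a b. a \<le> n \<Longrightarrow> b \<le> n \<Longrightarrow> q a b + q b a = q0 a b + q0 b a"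
    and "\<And>a b. a \<le> n \<Longrightarrow> b \<le> n \<Longrightarrow> a \<noteq> b \<Longrightarrow> q a b \<le> 0"
    and "\<And>a b. a \<le> n \<Longrightarrow> b \<le> n \<Longrightarrow> q a b < 0 \<Longrightarrow> d a \<le> d b + 1"
    and "\<And>a. a \<le> n \<Longrightarrow> e a < 0 \<Longrightarrow> d a = 0"
    and "\<And>a. a \<le> n \<Longrightarrow> c a \<le> n + 1"
    and "\<And>a. a \<le> n \<Longrightarrow> d a \<le> n + 2"
    and "\<And>a b. a \<le> n \<Longrightarrow> b < c a \<Longrightarrow> q a b < 0 \<Longrightarrow> d a \<le> d b"
    and "\<And>a. a \<le> n \<Longrightarrow> 0 < e a \<Longrightarrow> d a < n + 2 \<Longrightarrow> d a + 1 < h \<or> d a + 1 = h \<and> i \<le> a"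
    and "i \<le> n + 1"
  shows "preflow_inv n q0 e0 q e d c h i"
  unfolding preflow_inv_def using assms by (intro conjI allI impI) auto

text \<open>Only the condition on positive excesses and the range of \<open>i\<close> mention the
  scan position; everything else is inherited.\<close>

lemma preflow_move_scan:
  assumes inv: "preflow_inv n q0 e0 q e d c h i" and "i' \<le> n + 1"
    and "\<And>a. a \<le> n \<Longrightarrow> 0 < e a \<Longrightarrow> d a < n + 2 \<Longrightarrow> d a + 1 < h' \<or> d a + 1 = h' \<and> i' \<le> a"
  shows "preflow_inv n q0 e0 q e d c h' i'"
  by (rule preflow_invI) (fact preflow_invD[OF inv] assms)+

text \<open>At \<open>i = n + 1\<close> no vertex index is left at the scanned level, so every
  remaining active label lies strictly below it.\<close>

lemma preflow_level_down:
  assumes inv: "preflow_inv n q0 e0 q e d c h (n + 1)"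
  shows "preflow_inv n q0 e0 q e d c (h - 1) 0"
proof (rule preflow_move_scan[OF inv])
  fix a assume "a \<le> n" "0 < e a" "d a < n + 2"
  then show "d a + 1 < h - 1 \<or> d a + 1 = h - 1 \<and> 0 \<le> a"
    using preflow_invD(9)[OF inv, of a] by linarith
qed simp

lemma preflow_next_vertex:
  assumes inv: "preflow_inv n q0 e0 q e d c h i" and "i \<le> n"
    and idle: "\<not> (0 < e i \<and> d i < n + 2 \<and> \<not> d i + 1 < h)"
  shows "preflow_inv n q0 e0 q e d c h (i + 1)"
proof (rule preflow_move_scan[OF inv])
  fix a assume a: "a \<le> n" "0 < e a" "d a < n + 2"
  show "d a + 1 < h \<or> d a + 1 = h \<and> i + 1 \<le> a"
  proof (cases "a = i")
    case True
    then show ?thesis using idle a by blast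
  next
    case False
    then show ?thesis using preflow_invD(9)[OF inv a] by linarith
  qed
qed (use assms in simp)

lemma preflow_next_arc:
  assumes inv: "preflow_inv n q0 e0 q e d c h i" and "i \<le> n" "c i \<le> n"
    and inadm: "\<not> (q i (c i) < 0 \<and> d (c i) < d i)"
  shows "preflow_inv n q0 e0 q e d (c(i := c i + 1)) h i"
proof (rule preflow_invI)
  fix a assume "a \<le> n"
  then show "(c(i := c i + 1)) a \<le> n + 1"
    using preflow_invD(6)[OF inv, of a] \<open>c i \<le> n\<close> by simp
next
  fix a b assume a: "a \<le> n" "b < (c(i := c i + 1)) a" "q a b < 0"
  show "d a \<le> d b"
  proof (cases "a = i \<and> b = c i")
    case True
    then show ?thesis using inadm a(3) by (metis not_less)
  next
    case False
    then have "b < c a" using a(2) by (cases "a = i") simp_all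
    then show ?thesis using preflow_invD(8)[OF inv] a by blast
  qed
qed (fact preflow_invD[OF inv])+

text \<open>The current arc has passed all arcs out of \<open>i\<close>, so none of the residual
  ones leads downhill and raising the label by one keeps the labelling valid.\<close>

lemma preflow_relabel:
  assumes inv: "preflow_inv n q0 e0 q e d c h i" and i: "i \<le> n"
    and act: "0 < e i" "d i < n + 2" "\<not> d i + 1 < h" and "\<not> c i \<le> n"
  shows "preflow_inv n q0 e0 q e (d(i := d i + 1)) (c(i := 0)) (h + 1) i"
proof -
  have "c i = n + 1" using preflow_invD(6)[OF inv i] assms by simp
  then have out: "d i \<le> d b" if "b \<le> n" "q i b < 0" for b
    using preflow_invD(8)[OF inv i, of b] that by simp
  \<comment> \<open>The other active labels are at most \<open>h - 1\<close>. After the relabelling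
    only \<open>i\<close> can be active at level \<open>h\<close>, so the scan continues at
    \<open>i\<close> without rewinding.\<close>
  have h: "d i + 1 = h" using preflow_invD(9)[OF inv i] act by auto
  show ?thesis
  proof (rule preflow_invI)
    fix a b assume "a \<le> n" "b \<le> n" "q a b < 0"
    then show "(d(i := d i + 1)) a \<le> (d(i := d i + 1)) b + 1"
      using out[of b] preflow_invD(4)[OF inv, of a b] by auto
  next
    fix a b assume a: "a \<le> n" "b < (c(i := 0)) a" "q a b < 0"
    then have "a \<noteq> i" by (auto split: if_splits)
    moreover have "d a \<le> d b" using preflow_invD(8)[OF inv, of a b] a \<open>a \<noteq> i\<close> by simp
    ultimately show "(d(i := d i + 1)) a \<le> (d(i := d i + 1)) b" by auto
  next
    fix a assume "a \<le> n" "0 < e a" "(d(i := d i + 1)) a < n + 2"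
    then show "(d(i := d i + 1)) a + 1 < h + 1 \<or> (d(i := d i + 1)) a + 1 = h + 1 \<and> i \<le> a"
      using preflow_invD(9)[OF inv, of a] h by (cases "a = i") auto
  next
    fix a assume "a \<le> n"
    then show "(c(i := 0)) a \<le> n + 1" "(d(i := d i + 1)) a \<le> n + 2"
      using preflow_invD(6,7)[OF inv, of a] act by simp_all
  next
    fix a assume "a \<le> n" "e a < 0"
    then show "(d(i := d i + 1)) a = 0"
      using preflow_invD(5)[OF inv, of a] act by (cases "a = i") simp_all
  qed (fact preflow_invD[OF inv])+
qed

text \<open>Capacities are stored negated, so using up capacity of the arc from \<open>u\<close> to
  \<open>v\<close> means adding there. The antisymmetric change preserves
  \<open>q a b + q b a\<close>, and the row sums change by exactly what the excesses lose or
  gain.\<close>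

definition push :: "nat \<Rightarrow> nat \<Rightarrow> real \<Rightarrow> (nat \<Rightarrow> nat \<Rightarrow> real) \<Rightarrow> nat \<Rightarrow> nat \<Rightarrow> real" where
  "push u v \<delta> q a b = q a b + (if a = u \<and> b = v then \<delta> else 0) - (if a = v \<and> b = u then \<delta> else 0)"

text \<open>The only arc that can become residual is the reverse one, from \<open>v\<close> to
  \<open>i\<close>. It leads uphill, so the labelling and the current arcs survive, and
  \<open>v\<close> lies below the scanned level, so its new excess does not disturb the
  scan.\<close>

lemma preflow_push:
  assumes inv: "preflow_inv n q0 e0 q e d c h i" and i: "i \<le> n"
    and act: "d i < n + 2" "\<not> d i + 1 < h" and v: "v \<le> n" "d v < d i"
    and \<delta>: "0 < \<delta>" "\<delta> \<le> e i" "\<delta> \<le> - q i v"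
  shows "preflow_inv n q0 e0 (push i v \<delta> q) (e(i := e i - \<delta>, v := e v + \<delta>)) d c h i"
    (is "preflow_inv n q0 e0 ?q ?e d c h i")
proof -
  have [simp]: "i \<noteq> v" "v \<noteq> i" using v by auto
  have h: "d i + 1 = h"
    using preflow_invD(9)[OF inv i] act \<delta> by auto
  have row: "(\<Sum>b\<le>n. ?q a b) = (\<Sum>b\<le>n. q a b) + (if a = i then \<delta> else 0) - (if a = v then \<delta> else 0)"
    if "a \<le> n" for a
    using i v by (auto simp: push_def sum.distrib sum_subtractf)
  have new: "q a b < 0 \<or> a = v \<and> b = i" if "?q a b < 0" for a b
    using that \<delta> by (auto simp: push_def split: if_splits)
  show ?thesis
  proof (rule preflow_invI)
    fix a assume "a \<le> n"
    then show "(\<Sum>b\<le>n. ?q a b) + ?e a = e0 a"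
      using row[of a] preflow_invD(1)[OF inv, of a] by auto
  next
    fix a b assume "a \<le> n" "b \<le> n"
    moreover have "?q a b + ?q b a = q a b + q b a"
      by (auto simp: push_def)
    ultimately show "?q a b + ?q b a = q0 a b + q0 b a"
      using preflow_invD(2)[OF inv, of a b] by simp
  next
    fix a b assume "a \<le> n" "b \<le> n" "a \<noteq> b"
    then have "q a b \<le> 0" using preflow_invD(3)[OF inv, of a b] by simp
    then show "?q a b \<le> 0" using \<delta> by (auto simp: push_def)
  next
    fix a b assume "a \<le> n" "b \<le> n" "?q a b < 0"
    then show "d a \<le> d b + 1"
      using new[of a b] v preflow_invD(4)[OF inv, of a b] by auto
  next
    fix a b assume "a \<le> n" "b < c a" "?q a b < 0"
    then show "d a \<le> d b"
      using new[of a b] v preflow_invD(8)[OF inv, of a b] by auto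
  next
    fix a assume "a \<le> n" "?e a < 0"
    then show "d a = 0"
      using preflow_invD(5)[OF inv, of a] \<delta> by (auto split: if_splits)
  next
    fix a assume "a \<le> n" "0 < ?e a" "d a < n + 2"
    then show "d a + 1 < h \<or> d a + 1 = h \<and> i \<le> a"
      using preflow_invD(9)[OF inv, of a] h v \<delta> by (cases "a = v"; cases "a = i") auto
  qed (fact preflow_invD[OF inv])+
qed

text \<open>A relabelling decreases the first sum by one, resets one current arc and raises the scanned
  level, hence the factor \<open>2 * n + 4\<close>.\<close>

definition potential :: "nat \<Rightarrow> (nat \<Rightarrow> nat) \<Rightarrow> (nat \<Rightarrow> nat) \<Rightarrow> nat \<Rightarrow> nat \<Rightarrow> nat" where
  "potential n d c h i =
     (2 * n + 4) * (\<Sum>a\<le>n. n + 2 - d a) + (\<Sum>a\<le>n. n + 1 - c a) + (n + 2) * h + (n + 1 - i)"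

text \<open>Stated with additions on both sides to avoid truncated subtraction.\<close>

lemma sum_fun_upd_nat:
  fixes f :: "nat \<Rightarrow> nat \<Rightarrow> nat"
  assumes "i \<le> n"
  shows "(\<Sum>a\<le>n. f a ((d(i := x)) a)) + f i (d i) = (\<Sum>a\<le>n. f a (d a)) + f i x"
  using assms sum.remove[of "{..n}" i "\<lambda>a. f a ((d(i := x)) a)"]
    sum.remove[of "{..n}" i "\<lambda>a. f a (d a)"] by simp

text \<open>Restarting \<open>i\<close> at 0 costs \<open>n + 1\<close>, one less than the weight
  \<open>n + 2\<close> of a level.\<close>

lemma potential_level_down: "0 < h \<Longrightarrow> potential n d c (h - 1) 0 < potential n d c h (n + 1)"
  by (cases h) (auto simp: potential_def)

lemma potential_next_vertex: "i \<le> n \<Longrightarrow> potential n d c h (i + 1) < potential n d c h i"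
  by (auto simp: potential_def)

lemma potential_next_arc:
  "i \<le> n \<Longrightarrow> c i \<le> n \<Longrightarrow> potential n d (c(i := c i + 1)) h i < potential n d c h i"
  using sum_fun_upd_nat[of i n "\<lambda>a x. n + 1 - x" c "c i + 1"] by (simp add: potential_def)

lemma potential_relabel:
  assumes "i \<le> n" "d i < n + 2"
  shows "potential n (d(i := d i + 1)) (c(i := 0)) (h + 1) i < potential n d c h i"
proof -
  have "(\<Sum>a\<le>n. n + 2 - d a) = (\<Sum>a\<le>n. n + 2 - (d(i := d i + 1)) a) + 1"
    using sum_fun_upd_nat[of i n "\<lambda>a x. n + 2 - x" d "d i + 1"] assms by simp
  moreover have "(\<Sum>a\<le>n. n + 1 - (c(i := 0)) a) \<le> (\<Sum>a\<le>n. n + 1 - c a) + (n + 1)"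
    using sum_fun_upd_nat[of i n "\<lambda>a x. n + 1 - x" c 0] assms by simp
  ultimately show ?thesis
    unfolding potential_def by (simp add: algebra_simps)
qed

text \<open>The leading part is \<open>2 * (n + 1) * (n + 2)^2\<close>; the constant 4 is a
  comfortable round bound. The scan starts at \<open>h = 1\<close>, \<open>i = 0\<close> because all
  labels are 0.\<close>

lemma potential_init:
  assumes "\<And>a. a \<le> n \<Longrightarrow> d a = 0" "\<And>a. a \<le> n \<Longrightarrow> c a = 0"
  shows "potential n d c 1 0 < 4 * (n + 2) ^ 3"
proof -
  have "(\<Sum>a\<le>n. n + 2 - d a) = (n + 1) * (n + 2)" "(\<Sum>a\<le>n. n + 1 - c a) = (n + 1) * (n + 1)"
    using assms by simp_all
  then show ?thesis
    by (simp add: potential_def power3_eq_cube algebra_simps)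
qed

section \<open>Optimality of the vertices above an empty level\<close>

text \<open>Within \<open>T\<close> only the symmetric part of \<open>q\<close> counts, and pushes
  preserve it; the row identity accounts for the rest. The last sum, negated, is the residual
  capacity leaving \<open>T\<close>, so the formula is the duality between flows and cuts.\<close>

lemma set_objective_preflow:
  assumes inv: "preflow_inv n q0 e0 q e d c h i" and T: "T \<subseteq> {..n}"
  shows "set_objective q0 e0 T = - (\<Sum>a\<in>T. e a) - (\<Sum>a\<in>T. \<Sum>b\<in>{..n} - T. q a b)"
proof -
  have double: "2 * (\<Sum>a\<in>T. \<Sum>b\<in>T. f a b) = (\<Sum>a\<in>T. \<Sum>b\<in>T. f a b + f b a)" for f :: "nat \<Rightarrow> nat \<Rightarrow> real"
    using sum.swap[of f T T] by (simp add: sum.distrib)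
  have "(\<Sum>a\<in>T. \<Sum>b\<in>T. q a b + q b a) = (\<Sum>a\<in>T. \<Sum>b\<in>T. q0 a b + q0 b a)"
    using preflow_invD(2)[OF inv] T by (intro sum.cong refl) blast
  then have inner: "(\<Sum>a\<in>T. \<Sum>b\<in>T. q0 a b) = (\<Sum>a\<in>T. \<Sum>b\<in>T. q a b)"
    using double[of q] double[of q0] by simp
  have "e0 a = (\<Sum>b\<in>T. q a b) + (\<Sum>b\<in>{..n} - T. q a b) + e a" if "a \<in> T" for a
  proof -
    have "(\<Sum>b\<le>n. q a b) + e a = e0 a" using preflow_invD(1)[OF inv] T that by blast
    then show ?thesis using sum.subset_diff[OF T, of "q a"] by simp
  qed
  then have "(\<Sum>a\<in>T. e0 a) = (\<Sum>a\<in>T. (\<Sum>b\<in>T. q a b) + (\<Sum>b\<in>{..n} - T. q a b) + e a)"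
    by (intro sum.cong) auto
  then show ?thesis
    by (simp add: set_objective_def inner sum.distrib)
qed

text \<open>Weak duality bounds the objective of any \<open>T'\<close> below by minus its total
  excess. The vertices above the gap attain the least such value: they hold all positive excess, no
  deficit, and no residual arc leaves them, since it would drop by at least two labels.\<close>

lemma preflow_gap_optimal:
  assumes inv: "preflow_inv n q0 e0 q e d c 0 i"
    and l: "l < n + 2" and gap: "\<And>a. a \<le> n \<Longrightarrow> d a \<noteq> l" and T': "T' \<subseteq> {..n}"
  shows "set_objective q0 e0 {a. a \<le> n \<and> l < d a} \<le> set_objective q0 e0 T'"
proof -
  define T where "T = {a. a \<le> n \<and> l < d a}"
  have T: "T \<subseteq> {..n}" by (auto simp: T_def)
  have zero: "q a b = 0" if "a \<in> T" "b \<in> {..n} - T" for a b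
  proof -
    have "d a \<ge> l + 1" "d b < l" "a \<le> n" "b \<le> n" "a \<noteq> b"
      using that gap[of b] by (auto simp: T_def)
    then have "\<not> q a b < 0" using preflow_invD(4)[OF inv, of a b] by linarith
    then show ?thesis
      using preflow_invD(3)[OF inv \<open>a \<le> n\<close> \<open>b \<le> n\<close> \<open>a \<noteq> b\<close>] by linarith
  qed
  have pos: "0 \<le> e a" if "a \<in> T" for a
    using preflow_invD(5)[OF inv, of a] that by (force simp: T_def)
  \<comment> \<open>With \<open>h = 0\<close> positive excess survives only at label
    \<open>n + 2\<close>, which is above \<open>l\<close>.\<close>
  have neg: "e a \<le> 0" if "a \<le> n" "a \<notin> T" for a
    using preflow_invD(9)[OF inv, of a] that l by (force simp: T_def)
  have fin: "finite T" "finite T'" using T T' finite_subset by blast+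
  have "set_objective q0 e0 T = - (\<Sum>a\<in>T. e a)"
    using set_objective_preflow[OF inv T] zero by simp
  also have "\<dots> \<le> - (\<Sum>a\<in>T'. e a)"
  proof -
    have "(\<Sum>a\<in>T'. e a) = (\<Sum>a\<in>T' \<inter> T. e a) + (\<Sum>a\<in>T' - T. e a)"
      using fin sum.Int_Diff by blast
    also have "\<dots> \<le> (\<Sum>a\<in>T' \<inter> T. e a) + 0"
      using neg T' by (intro add_left_mono sum_nonpos) auto
    also have "\<dots> \<le> (\<Sum>a\<in>T. e a)"
      using sum_mono2[of T "T' \<inter> T" e] fin pos by auto
    finally show ?thesis by simp
  qed
  also have "\<dots> \<le> - (\<Sum>a\<in>T'. e a) - (\<Sum>a\<in>T'. \<Sum>b\<in>{..n} - T'. q a b)"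
  proof -
    have "(\<Sum>a\<in>T'. \<Sum>b\<in>{..n} - T'. q a b) \<le> 0"
      using preflow_invD(3)[OF inv] T' by (intro sum_nonpos) auto
    then show ?thesis by simp
  qed
  also have "\<dots> = set_objective q0 e0 T'"
    using set_objective_preflow[OF inv T'] by simp
  finally show ?thesis by (simp add: T_def)
qed

section \<open>The program\<close>

abbreviation nvar :: "string \<Rightarrow> nexp" where
  "nvar x \<equiv> NLoad x []"

abbreviation vertex_count :: nexp where
  "vertex_count \<equiv> NAdd (nvar ''n'') (NConst 1)"

abbreviation set_zero_vertex :: com where
  "set_zero_vertex \<equiv>
     Seq (NStore ''j'' [] (NConst 0))
     (Seq (RStore ''e'' [nvar ''i''] (RConst 0))
     (Seq (NStore ''d'' [nvar ''i''] (NConst 0))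
          (NStore ''c'' [nvar ''i''] (NConst 0))))"

definition init_start :: com where
  "init_start = Seq (NStore ''i'' [] (NConst 0)) set_zero_vertex"

text \<open>The double loop over \<open>i\<close> and \<open>j\<close> as one loop: while
  \<open>j\<close> is in range a term of the excess is added, otherwise the next vertex is
  prepared.\<close>

definition init_body :: com where
  "init_body =
     Cond (NLess (nvar ''j'') vertex_count)
       (Seq (RStore ''e'' [nvar ''i'']
               (RAdd (RLoad ''e'' [nvar ''i''])
                  (RMul (RConst 2) (RMul (RLoad ''q'' [nvar ''i'', nvar ''j'']) (RLoad ''p'' [nvar ''j''])))))
            (NStore ''j'' [] (NAdd (nvar ''j'') (NConst 1))))
       (Seq (NStore ''i'' [] (NAdd (nvar ''i'') (NConst 1))) set_zero_vertex)"

definition flow_start :: com where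
  "flow_start = Seq (NStore ''h'' [] (NConst 1)) (NStore ''i'' [] (NConst 0))"

abbreviation "excess_i \<equiv> RLoad ''e'' [nvar ''i'']"
abbreviation "label_i \<equiv> NLoad ''d'' [nvar ''i'']"
abbreviation "arc_i \<equiv> NLoad ''c'' [nvar ''i'']"
abbreviation "q_out \<equiv> RLoad ''q'' [nvar ''i'', nvar ''v'']"
abbreviation "q_in \<equiv> RLoad ''q'' [nvar ''v'', nvar ''i'']"

abbreviation next_vertex :: com where
  "next_vertex \<equiv> NStore ''i'' [] (NAdd (nvar ''i'') (NConst 1))"

abbreviation next_arc :: com where
  "next_arc \<equiv> NStore ''c'' [nvar ''i''] (NAdd arc_i (NConst 1))"

abbreviation push_x :: com where
  "push_x \<equiv>
     Seq (RStore ''e'' [nvar ''i''] (RSub excess_i (RLoad ''x'' [])))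
     (Seq (RStore ''e'' [nvar ''v''] (RAdd (RLoad ''e'' [nvar ''v'']) (RLoad ''x'' [])))
     (Seq (RStore ''q'' [nvar ''i'', nvar ''v''] (RAdd q_out (RLoad ''x'' [])))
          (RStore ''q'' [nvar ''v'', nvar ''i''] (RSub q_in (RLoad ''x'' [])))))"

text \<open>A push that leaves capacity exhausts the excess, so the vertex is left while its arc
  stays current. In the other case, ties included, the arc is saturated and becomes obsolete
  instead.\<close>

definition discharge_step :: com where
  "discharge_step =
     Seq (NStore ''v'' [] arc_i)
     (Cond (NLess (nvar ''v'') vertex_count)
       (Cond (BAnd (RLess q_out (RConst 0)) (NLess (NLoad ''d'' [nvar ''v'']) label_i))
         (Cond (RLess excess_i (RSub (RConst 0) q_out))
           (Seq (RStore ''x'' [] excess_i) (Seq push_x next_vertex))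
           (Seq (RStore ''x'' [] (RSub (RConst 0) q_out)) (Seq push_x next_arc)))
         next_arc)
       (Seq (NStore ''d'' [nvar ''i''] (NAdd label_i (NConst 1)))
       (Seq (NStore ''c'' [nvar ''i''] (NConst 0))
            (NStore ''h'' [] (NAdd (nvar ''h'') (NConst 1))))))"

text \<open>The variable \<open>h\<close> is the scanned level plus one, so that 0 can mean that no
  level is left. Under the invariant the negated comparison with \<open>h\<close> amounts to
  equality.\<close>

definition flow_body :: com where
  "flow_body =
     Cond (NLess (nvar ''i'') vertex_count)
       (Cond (BAnd (RLess (RConst 0) excess_i)
                (BAnd (NLess label_i (NAdd (nvar ''n'') (NConst 2)))
                   (BNot (NLess (NAdd label_i (NConst 1)) (nvar ''h'')))))
         discharge_step
         next_vertex)
       (Seq (NStore ''h'' [] (NSub (nvar ''h'') (NConst 1))) (NStore ''i'' [] (NConst 0)))"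

definition gap_start :: com where
  "gap_start = Seq (NStore ''h'' [] (NConst 0)) (NStore ''i'' [] (NConst 0))"

text \<open>\<open>h\<close> is the candidate level: a vertex found on it advances the candidate and
  restarts the search. No upper limit on \<open>h\<close> is tested, as the pigeonhole principle
  supplies one.\<close>

definition gap_body :: com where
  "gap_body =
     Cond (BAnd (BNot (NLess label_i (nvar ''h''))) (BNot (NLess (nvar ''h'') label_i)))
       (Seq (NStore ''h'' [] (NAdd (nvar ''h'') (NConst 1))) (NStore ''i'' [] (NConst 0)))
       next_vertex"

definition output_start :: com where
  "output_start = NStore ''i'' [] (NConst 0)"

definition output_body :: com where
  "output_body =
     Seq (Cond (NLess (nvar ''h'') label_i)
            (RStore ''t'' [nvar ''i''] (RConst 1))
            (RStore ''t'' [nvar ''i''] (RConst 0)))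
         next_vertex"

abbreviation more_vertices :: bexp where
  "more_vertices \<equiv> NLess (nvar ''i'') vertex_count"

abbreviation more_levels :: bexp where
  "more_levels \<equiv> NLess (NConst 0) (nvar ''h'')"

definition min_cut_program :: com where
  "min_cut_program =
     Seq init_start (Seq (While more_vertices init_body)
     (Seq flow_start (Seq (While more_levels flow_body)
     (Seq gap_start (Seq (While more_vertices gap_body)
     (Seq output_start (While more_vertices output_body)))))))"

section \<open>Loop invariants and measures\<close>

definition init_inv ::
    "nat \<Rightarrow> (nat \<Rightarrow> nat \<Rightarrow> real) \<Rightarrow> real vec \<Rightarrow> store \<Rightarrow> bool" where
  "init_inv n q p s \<longleftrightarrow> input_stored n q p s \<and>
     (let i = nats s ''i'' []; j = nats s ''j'' [] in
       i \<le> n + 1 \<and> j \<le> n + 1 \<and>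
       (\<forall>a\<le>i. nats s ''d'' [a] = 0 \<and> nats s ''c'' [a] = 0) \<and>
       (\<forall>a<i. reals s ''e'' [a] = 2 * (\<Sum>b\<le>n. q a b * p $ b)) \<and>
       (i \<le> n \<longrightarrow> reals s ''e'' [i] = 2 * (\<Sum>b<j. q i b * p $ b)))"

text \<open>The measure is lexicographic in \<open>i\<close> and \<open>j\<close>: the weight
  \<open>n + 2\<close> outweighs the \<open>n + 1\<close> regained when \<open>j\<close> is
  reset.\<close>

lemma init_body_step:
  assumes "init_inv n q p s" "bval more_vertices s"
  shows "init_inv n q p (run init_body s) \<and>
    (n + 1 - nats (run init_body s) ''i'' []) * (n + 2) + (n + 1 - nats (run init_body s) ''j'' []) <
    (n + 1 - nats s ''i'' []) * (n + 2) + (n + 1 - nats s ''j'' [])"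
proof -
  define i where "i = nats s ''i'' []"
  define j where "j = nats s ''j'' []"
  have n: "nats s ''n'' [] = n" and i: "i \<le> n"
    using assms by (auto simp: init_inv_def input_stored_def i_def Let_def)
  show ?thesis
  proof (cases "j \<le> n")
    case True
    then show ?thesis
      using assms(1) n i unfolding init_inv_def input_stored_def init_body_def
      by (auto simp: Let_def i_def[symmetric] j_def[symmetric] algebra_simps)
  next
    case False
    then have j: "j = n + 1"
      using assms(1) by (auto simp: init_inv_def Let_def j_def)
    obtain k where k: "n + 1 - i = Suc k" using i by (cases "n + 1 - i") auto
    then have "n - i = k" by simp
    have e: "\<forall>a\<le>i. reals s ''e'' [a] = 2 * (\<Sum>b\<le>n. q a b * p $ b)"
      using assms(1) j i
      by (auto simp: init_inv_def Let_def i_def[symmetric] j_def[symmetric] lessThan_Suc_atMost le_less)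
    show ?thesis
      using assms(1) n i j e k \<open>n - i = k\<close> unfolding init_inv_def input_stored_def init_body_def
      by (auto simp: Let_def i_def[symmetric] j_def[symmetric])
  qed
qed

definition flow_inv ::
    "nat \<Rightarrow> (nat \<Rightarrow> nat \<Rightarrow> real) \<Rightarrow> (nat \<Rightarrow> real) \<Rightarrow> store \<Rightarrow> bool" where
  "flow_inv n q0 e0 s \<longleftrightarrow> nats s ''n'' [] = n \<and>
     preflow_inv n q0 e0 (\<lambda>a b. reals s ''q'' [a, b]) (\<lambda>a. reals s ''e'' [a])
       (\<lambda>a. nats s ''d'' [a]) (\<lambda>a. nats s ''c'' [a]) (nats s ''h'' []) (nats s ''i'' [])"

definition flow_potential :: "nat \<Rightarrow> store \<Rightarrow> nat" where
  "flow_potential n s =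
     potential n (\<lambda>a. nats s ''d'' [a]) (\<lambda>a. nats s ''c'' [a]) (nats s ''h'' []) (nats s ''i'' [])"

text \<open>Carries a step on abstract functions over to the store. The pointwise equations let each
  array assignment be compared with a function update.\<close>

lemma flow_step_transfer:
  assumes "preflow_inv n q0 e0 q e d c h i \<and> potential n d c h i < flow_potential n s"
    and "nats s' ''n'' [] = n"
    and "\<And>a b. reals s' ''q'' [a, b] = q a b" "\<And>a. reals s' ''e'' [a] = e a"
    and "\<And>a. nats s' ''d'' [a] = d a" "\<And>a. nats s' ''c'' [a] = c a"
    and "nats s' ''h'' [] = h" "nats s' ''i'' [] = i"
  shows "flow_inv n q0 e0 s' \<and> flow_potential n s' < flow_potential n s"
  using assms by (simp add: flow_inv_def flow_potential_def)

lemma flow_body_step: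
  assumes inv: "flow_inv n q0 e0 s" and more: "bval more_levels s"
  shows "flow_inv n q0 e0 (run flow_body s) \<and>
    flow_potential n (run flow_body s) < flow_potential n s"
proof -
  define q where "q = (\<lambda>a b. reals s ''q'' [a, b])"
  define e where "e = (\<lambda>a. reals s ''e'' [a])"
  define d where "d = (\<lambda>a. nats s ''d'' [a])"
  define c where "c = (\<lambda>a. nats s ''c'' [a])"
  define h where "h = nats s ''h'' []"
  define i where "i = nats s ''i'' []"
  note vars = q_def e_def d_def c_def h_def i_def
  have n: "nats s ''n'' [] = n" and pre: "preflow_inv n q0 e0 q e d c h i"
    using inv by (simp_all add: flow_inv_def vars)
  have pot: "flow_potential n s = potential n d c h i"
    by (simp add: flow_potential_def vars)
  have h: "0 < h" using more by (simp add: h_def)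
  have loads: "reals s ''q'' [a, b] = q a b" "reals s ''e'' [a] = e a" "nats s ''d'' [a] = d a"
    "nats s ''c'' [a] = c a" "nats s ''h'' [] = h" "nats s ''i'' [] = i" for a b
    by (simp_all add: vars)
  define active where "active \<longleftrightarrow> 0 < e i \<and> d i < n + 2 \<and> \<not> d i + 1 < h"
  define admissible where "admissible \<longleftrightarrow> q i (c i) < 0 \<and> d (c i) < d i"
  \<comment> \<open>The body is evaluated symbolically once, so that each case below meets exactly
    one combinatorial step.\<close>
  have scan: "run flow_body s =
      (if \<not> i \<le> n then nstore ''i'' [] 0 (nstore ''h'' [] (h - 1) s)
       else if active then run discharge_step s else nstore ''i'' [] (i + 1) s)"
    unfolding active_def by (auto simp: flow_body_def loads n)
  have discharge: "run discharge_step s =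
      (if \<not> c i \<le> n then
         nstore ''h'' [] (h + 1) (nstore ''c'' [i] 0 (nstore ''d'' [i] (d i + 1) (nstore ''v'' [] (c i) s)))
       else if admissible then
         (if e i < - q i (c i)
          then run (Seq (RStore ''x'' [] excess_i) (Seq push_x next_vertex)) (nstore ''v'' [] (c i) s)
          else run (Seq (RStore ''x'' [] (RSub (RConst 0) q_out)) (Seq push_x next_arc))
            (nstore ''v'' [] (c i) s))
       else nstore ''c'' [i] (c i + 1) (nstore ''v'' [] (c i) s))"
    unfolding admissible_def by (auto simp: discharge_step_def loads n)
  consider "\<not> i \<le> n" | "i \<le> n" "\<not> active" | "i \<le> n" "active" "\<not> c i \<le> n"
    | "i \<le> n" "active" "c i \<le> n" "\<not> admissible"
    | "i \<le> n" "active" "c i \<le> n" "admissible" "e i < - q i (c i)"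
    | "i \<le> n" "active" "c i \<le> n" "admissible" "\<not> e i < - q i (c i)"
    by blast
  then show ?thesis
  proof cases
    case 1
    then have "i = n + 1" using preflow_invD(10)[OF pre] by simp
    then have "preflow_inv n q0 e0 q e d c (h - 1) 0 \<and>
        potential n d c (h - 1) 0 < flow_potential n s"
      using preflow_level_down pre potential_level_down[OF h] unfolding pot by simp
    then show ?thesis
      by (rule flow_step_transfer) (simp_all add: scan 1 loads n)
  next
    case 2
    then have "preflow_inv n q0 e0 q e d c h (i + 1) \<and> potential n d c h (i + 1) < flow_potential n s"
      using preflow_next_vertex[OF pre] potential_next_vertex unfolding active_def pot by blast
    then show ?thesis
      by (rule flow_step_transfer) (simp_all add: scan 2 loads n)
  next
    case 3
    then have "preflow_inv n q0 e0 q e (d(i := d i + 1)) (c(i := 0)) (h + 1) i \<and>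
        potential n (d(i := d i + 1)) (c(i := 0)) (h + 1) i < flow_potential n s"
      using preflow_relabel[OF pre] potential_relabel unfolding active_def pot by blast
    then show ?thesis
      by (rule flow_step_transfer) (simp_all add: scan discharge 3 loads n eq_commute)
  next
    case 4
    then have "preflow_inv n q0 e0 q e d (c(i := c i + 1)) h i \<and>
        potential n d (c(i := c i + 1)) h i < flow_potential n s"
      using preflow_next_arc[OF pre] potential_next_arc unfolding admissible_def pot by blast
    then show ?thesis
      by (rule flow_step_transfer) (simp_all add: scan discharge 4 loads n eq_commute)
  next
    case 5
    let ?v = "c i" and ?\<delta> = "e i"
    have "?v \<noteq> i" using 5 by (auto simp: admissible_def)
    have "preflow_inv n q0 e0 (push i ?v ?\<delta> q) (e(i := e i - ?\<delta>, ?v := e ?v + ?\<delta>)) d c h i"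
      using 5 by (intro preflow_push[OF pre]) (auto simp: active_def admissible_def)
    \<comment> \<open>The push has emptied \<open>i\<close>, so the scan may pass it.\<close>
    then have "preflow_inv n q0 e0 (push i ?v ?\<delta> q) (e(i := e i - ?\<delta>, ?v := e ?v + ?\<delta>)) d c h (i + 1)"
      using 5 \<open>?v \<noteq> i\<close> by (intro preflow_next_vertex) simp_all
    then have "preflow_inv n q0 e0 (push i ?v ?\<delta> q) (e(i := e i - ?\<delta>, ?v := e ?v + ?\<delta>)) d c h (i + 1) \<and>
        potential n d c h (i + 1) < flow_potential n s"
      using 5 potential_next_vertex unfolding pot by blast
    then show ?thesis
      by (rule flow_step_transfer)
        (use \<open>?v \<noteq> i\<close> in \<open>auto simp: scan discharge 5 loads n push_def\<close>)
  next
    case 6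
    let ?v = "c i" and ?\<delta> = "- q i (c i)"
    have "?v \<noteq> i" using 6 by (auto simp: admissible_def)
    have "preflow_inv n q0 e0 (push i ?v ?\<delta> q) (e(i := e i - ?\<delta>, ?v := e ?v + ?\<delta>)) d c h i"
      using 6 by (intro preflow_push[OF pre]) (auto simp: active_def admissible_def)
    \<comment> \<open>The push has used up the capacity of the arc, which is therefore no longer
      admissible.\<close>
    then have "preflow_inv n q0 e0 (push i ?v ?\<delta> q) (e(i := e i - ?\<delta>, ?v := e ?v + ?\<delta>)) d
        (c(i := c i + 1)) h i"
      using 6 \<open>?v \<noteq> i\<close> by (intro preflow_next_arc) (simp_all add: push_def)
    then have "preflow_inv n q0 e0 (push i ?v ?\<delta> q) (e(i := e i - ?\<delta>, ?v := e ?v + ?\<delta>)) d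
        (c(i := c i + 1)) h i \<and> potential n d (c(i := c i + 1)) h i < flow_potential n s"
      using 6 potential_next_arc unfolding pot by blast
    then show ?thesis
      by (rule flow_step_transfer)
        (use \<open>?v \<noteq> i\<close> in \<open>auto simp: scan discharge 6 loads n push_def\<close>)
  qed
qed

definition gap_inv :: "nat \<Rightarrow> (nat \<Rightarrow> nat) \<Rightarrow> store \<Rightarrow> bool" where
  "gap_inv n d s \<longleftrightarrow> nats s ''n'' [] = n \<and> (\<forall>a\<le>n. nats s ''d'' [a] = d a) \<and>
     nats s ''i'' [] \<le> n + 1 \<and>
     (\<forall>l<nats s ''h'' []. l \<in> d ` {..n}) \<and> (\<forall>a<nats s ''i'' []. d a \<noteq> nats s ''h'' [])"

text \<open>Pigeonhole: the levels below \<open>h\<close> are all occupied, by only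
  \<open>n + 1\<close> vertices.\<close>

lemma gap_level_le:
  assumes "gap_inv n d s"
  shows "nats s ''h'' [] \<le> n + 1"
proof -
  have "{..<nats s ''h'' []} \<subseteq> d ` {..n}"
    using assms by (auto simp: gap_inv_def)
  then have "card {..<nats s ''h'' []} \<le> card {..n}"
    using surj_card_le by blast
  then show ?thesis by simp
qed

lemma gap_body_step:
  assumes inv: "gap_inv n d s" and more: "bval more_vertices s"
  shows "gap_inv n d (run gap_body s) \<and>
    (n + 1 - nats (run gap_body s) ''h'' []) * (n + 2) + (n + 1 - nats (run gap_body s) ''i'' []) <
    (n + 1 - nats s ''h'' []) * (n + 2) + (n + 1 - nats s ''i'' [])"
proof -
  define i where "i = nats s ''i'' []"
  define h where "h = nats s ''h'' []"
  have n: "nats s ''n'' [] = n" and i: "i \<le> n" and di: "nats s ''d'' [i] = d i"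
    using assms by (auto simp: gap_inv_def i_def)
  show ?thesis
  proof (cases "d i = h")
    case True
    have run: "run gap_body s = nstore ''i'' [] 0 (nstore ''h'' [] (h + 1) s)"
      using True di by (simp add: gap_body_def i_def[symmetric] h_def[symmetric])
    have "h \<in> d ` {..n}" using True i by auto
    then have inv': "gap_inv n d (run gap_body s)"
      using inv unfolding run by (auto simp: gap_inv_def h_def less_Suc_eq)
    moreover have "nats (run gap_body s) ''h'' [] = h + 1" "nats (run gap_body s) ''i'' [] = 0"
      using run by simp_all
    moreover have "(n + 1 - (h + 1)) * (n + 2) + (n + 1) < (n + 1 - h) * (n + 2)"
    proof -
      \<comment> \<open>The bound is taken at the new state; it ensures that the truncated
        subtraction really decreases.\<close>
      have "h + 1 \<le> n + 1" using gap_level_le[OF inv'] \<open>nats (run gap_body s) ''h'' [] = h + 1\<close> by simp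
      then obtain k where "n = h + k" using le_Suc_ex by auto
      then show ?thesis by (simp add: Suc_diff_le)
    qed
    ultimately show ?thesis
      using trans_less_add1[of _ "(n + 1 - h) * (n + 2)" "n + 1 - nats s ''i'' []"]
      by (simp only: h_def diff_zero)
  next
    case False
    have run: "run gap_body s = nstore ''i'' [] (i + 1) s"
      using False di by (auto simp: gap_body_def i_def[symmetric] h_def[symmetric])
    have "gap_inv n d (run gap_body s)"
      using inv False i unfolding run by (auto simp: gap_inv_def h_def i_def less_Suc_eq)
    moreover have "n + 1 - (i + 1) < n + 1 - i" using i by simp
    moreover have "nats (run gap_body s) ''h'' [] = h" "nats (run gap_body s) ''i'' [] = i + 1"
      unfolding run by (simp_all add: h_def)
    ultimately show ?thesis by (simp only: h_def i_def add_less_cancel_left)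
  qed
qed

definition output_inv :: "nat \<Rightarrow> (nat \<Rightarrow> nat) \<Rightarrow> nat \<Rightarrow> store \<Rightarrow> bool" where
  "output_inv n d l s \<longleftrightarrow> nats s ''n'' [] = n \<and> (\<forall>a\<le>n. nats s ''d'' [a] = d a) \<and>
     nats s ''h'' [] = l \<and> nats s ''i'' [] \<le> n + 1 \<and>
     (\<forall>a<nats s ''i'' []. reals s ''t'' [a] = (if l < d a then 1 else 0))"

lemma output_body_step:
  assumes "output_inv n d l s" "bval more_vertices s"
  shows "output_inv n d l (run output_body s) \<and>
    n + 1 - nats (run output_body s) ''i'' [] < n + 1 - nats s ''i'' []"
  using assms unfolding output_inv_def output_body_def by (auto simp: less_Suc_eq)

section \<open>Total correctness and running time\<close>

text \<open>The factor 4 comes from \<open>potential_init\<close>; the one-off costs are absorbed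
  into the cubic term as well.\<close>

definition program_const :: nat where
  "program_const =
     max_cost init_start + (1 + bcost more_vertices + max_cost init_body) +
     max_cost flow_start + 4 * (1 + bcost more_levels + max_cost flow_body) +
     max_cost gap_start + (1 + bcost more_vertices + max_cost gap_body) +
     max_cost output_start + (1 + bcost more_vertices + max_cost output_body)"

lemma min_cut_program_correct:
  fixes n :: nat and q p
  defines "e0 \<equiv> \<lambda>a. 2 * (\<Sum>b\<le>n. q a b * p $ b)"
  assumes input: "input_stored n q p s"
    and row: "\<And>a. a \<le> n \<Longrightarrow> (\<Sum>b\<le>n. q a b) = 0"
    and nonpos: "\<And>a b. a \<le> n \<Longrightarrow> b \<le> n \<Longrightarrow> a \<noteq> b \<Longrightarrow> q a b \<le> 0"
  shows "runs_within min_cut_program s (program_const * (n + 2) ^ 3)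
    (\<lambda>s'. \<exists>T\<subseteq>{..n}. output_vec n s' = indicator_vec n T \<and>
       (\<forall>T'\<subseteq>{..n}. set_objective q e0 T \<le> set_objective q e0 T'))"
proof -
  define N where "N = (n + 2) ^ 3"
  define optimal where "optimal = (\<lambda>T. \<forall>T'\<subseteq>{..n}. set_objective q e0 T \<le> set_objective q e0 T')"
  \<comment> \<open>These are the largest starting values of the loop measures for initialisation
    and gap search, and for output.\<close>
  have N: "(n + 1) * (n + 2) + (n + 1) < N" "n + 1 < N"
    by (simp_all add: N_def power3_eq_cube algebra_simps)

  \<comment> \<open>The phases are treated from the last to the first, each together with all that
    follows it, since the resulting set depends on the level found by the gap search.\<close>
  have emit: "runs_within (Seq output_start (While more_vertices output_body)) s
      (max_cost output_start + N * (1 + bcost more_vertices + max_cost output_body))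
      (\<lambda>s'. output_vec n s' = indicator_vec n {a. a \<le> n \<and> l < d a})"
    if "gap_inv n d s" "nats s ''h'' [] = l" for s d l
  proof (rule runs_within_Seq)
    show "runs_within output_start s (max_cost output_start)
        (\<lambda>s'. output_inv n d l s' \<and> n + 1 - nats s' ''i'' [] < N)"
      using that N by (intro runs_within_run) (auto simp: output_start_def output_inv_def gap_inv_def)
  next
    fix s' assume s': "output_inv n d l s' \<and> n + 1 - nats s' ''i'' [] < N"
    have "runs_within (While more_vertices output_body) s'
        (N * (1 + bcost more_vertices + max_cost output_body))
        (\<lambda>s'. output_inv n d l s' \<and> \<not> bval more_vertices s')"
      using s' output_body_step
      by (intro runs_within_While[where \<mu> = "\<lambda>s. n + 1 - nats s ''i'' []"])
        (simp add: output_body_def, blast+)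
    then show "runs_within (While more_vertices output_body) s'
        (N * (1 + bcost more_vertices + max_cost output_body))
        (\<lambda>s'. output_vec n s' = indicator_vec n {a. a \<le> n \<and> l < d a})"
    proof (rule runs_within_weaken)
      fix s' assume "output_inv n d l s' \<and> \<not> bval more_vertices s'"
      then show "output_vec n s' = indicator_vec n {a. a \<le> n \<and> l < d a}"
        by (intro eq_vecI) (auto simp: output_vec_def indicator_vec_def output_inv_def)
    qed simp
  qed

  have gap: "runs_within (Seq gap_start (Seq (While more_vertices gap_body)
        (Seq output_start (While more_vertices output_body)))) s
      (max_cost gap_start + (N * (1 + bcost more_vertices + max_cost gap_body) +
        (max_cost output_start + N * (1 + bcost more_vertices + max_cost output_body))))
      (\<lambda>s'. \<exists>T\<subseteq>{..n}. output_vec n s' = indicator_vec n T \<and> optimal T)"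
    if inv: "flow_inv n q e0 s" and "nats s ''h'' [] = 0" for s
  proof -
    define d where "d = (\<lambda>a. nats s ''d'' [a])"
    have start: "runs_within gap_start s (max_cost gap_start) (\<lambda>s'. gap_inv n d s' \<and>
          (n + 1 - nats s' ''h'' []) * (n + 2) + (n + 1 - nats s' ''i'' []) < N)"
        using inv N by (intro runs_within_run) (auto simp: gap_start_def gap_inv_def flow_inv_def d_def)
    show ?thesis
    proof (rule runs_within_Seq[OF start], goal_cases)
      case (1 s1)
      show ?case
      proof (rule runs_within_Seq)
        show "runs_within (While more_vertices gap_body) s1
            (N * (1 + bcost more_vertices + max_cost gap_body))
            (\<lambda>s'. gap_inv n d s' \<and> \<not> bval more_vertices s')"
          using 1 gap_body_step
          by (intro runs_within_While[where
                \<mu> = "\<lambda>s. (n + 1 - nats s ''h'' []) * (n + 2) + (n + 1 - nats s ''i'' [])"])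
            (simp add: gap_body_def, blast+)
      next
        fix s2 assume s2: "gap_inv n d s2 \<and> \<not> bval more_vertices s2"
        define l where "l = nats s2 ''h'' []"
        have "d a \<noteq> l" if "a \<le> n" for a
          using s2 that by (auto simp: gap_inv_def l_def)
        moreover have "l < n + 2"
          using gap_level_le[of n d s2] s2 by (simp add: l_def)
        moreover have "preflow_inv n q e0 (\<lambda>a b. reals s ''q'' [a, b]) (\<lambda>a. reals s ''e'' [a]) d
            (\<lambda>a. nats s ''c'' [a]) 0 (nats s ''i'' [])"
          using that by (simp add: flow_inv_def d_def)
        ultimately have "optimal {a. a \<le> n \<and> l < d a}"
          unfolding optimal_def using preflow_gap_optimal by blast
        then have ex: "\<exists>T\<subseteq>{..n}. indicator_vec n {a. a \<le> n \<and> l < d a} = indicator_vec n T \<and> optimal T"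
          by (intro exI[of _ "{a. a \<le> n \<and> l < d a}"]) (simp add: subset_iff)
        show "runs_within (Seq output_start (While more_vertices output_body)) s2
            (max_cost output_start + N * (1 + bcost more_vertices + max_cost output_body))
            (\<lambda>s'. \<exists>T\<subseteq>{..n}. output_vec n s' = indicator_vec n T \<and> optimal T)"
        proof (rule runs_within_weaken[OF emit[of d s2 l]])
          show "gap_inv n d s2" "nats s2 ''h'' [] = l" using s2 by (simp_all add: l_def)
        qed (simp_all only: ex order_refl)
      qed
    qed
  qed

  have flow: "runs_within (Seq flow_start (Seq (While more_levels flow_body)
        (Seq gap_start (Seq (While more_vertices gap_body)
        (Seq output_start (While more_vertices output_body)))))) s
      (max_cost flow_start + (4 * N * (1 + bcost more_levels + max_cost flow_body) +
        (max_cost gap_start + (N * (1 + bcost more_vertices + max_cost gap_body) +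
        (max_cost output_start + N * (1 + bcost more_vertices + max_cost output_body))))))
      (\<lambda>s'. \<exists>T\<subseteq>{..n}. output_vec n s' = indicator_vec n T \<and> optimal T)"
    if inv: "init_inv n q p s" and finished: "\<not> bval more_vertices s" for s
  proof -
    \<comment> \<open>Zero row sums make the initial excesses satisfy the row identity before any
      push; zero labels and arcs settle the remaining conditions.\<close>
    have "preflow_inv n q e0 (\<lambda>a b. reals s ''q'' [a, b]) (\<lambda>a. reals s ''e'' [a])
        (\<lambda>a. nats s ''d'' [a]) (\<lambda>a. nats s ''c'' [a]) 1 0"
    proof -
      have eqs: "reals s ''q'' [a, b] = q a b" "nats s ''d'' [a] = 0" "nats s ''c'' [a] = 0"
        "reals s ''e'' [a] = e0 a" if "a \<le> n" "b \<le> n" for a b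
        using inv finished that by (auto simp: init_inv_def input_stored_def Let_def e0_def)
      show ?thesis
        by (rule preflow_invI) (auto simp: eqs row nonpos)
    qed
    moreover have "potential n (\<lambda>a. nats s ''d'' [a]) (\<lambda>a. nats s ''c'' [a]) 1 0 < 4 * N"
      unfolding N_def using inv finished
      by (intro potential_init) (auto simp: init_inv_def input_stored_def Let_def)
    ultimately have start: "runs_within flow_start s (max_cost flow_start)
        (\<lambda>s'. flow_inv n q e0 s' \<and> flow_potential n s' < 4 * N)"
      using inv by (intro runs_within_run)
        (simp_all add: flow_start_def flow_inv_def flow_potential_def init_inv_def input_stored_def)
    show ?thesis
    proof (rule runs_within_Seq[OF start], goal_cases)
      case (1 s1)
      show ?case
      proof (rule runs_within_Seq)
        show "runs_within (While more_levels flow_body) s1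
            (4 * N * (1 + bcost more_levels + max_cost flow_body))
            (\<lambda>s'. flow_inv n q e0 s' \<and> \<not> bval more_levels s')"
          using 1 flow_body_step
          by (intro runs_within_While[where \<mu> = "flow_potential n"])
            (simp add: flow_body_def discharge_step_def, blast+)
      qed (elim conjE, rule gap, assumption, simp)
    qed
  qed

  have start: "runs_within init_start s (max_cost init_start) (\<lambda>s'. init_inv n q p s' \<and>
      (n + 1 - nats s' ''i'' []) * (n + 2) + (n + 1 - nats s' ''j'' []) < N)"
    using input N by (intro runs_within_run) (auto simp: init_start_def init_inv_def input_stored_def)
  have total: "runs_within min_cut_program s
      (max_cost init_start + (N * (1 + bcost more_vertices + max_cost init_body) +
      (max_cost flow_start + (4 * N * (1 + bcost more_levels + max_cost flow_body) +
        (max_cost gap_start + (N * (1 + bcost more_vertices + max_cost gap_body) +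
        (max_cost output_start + N * (1 + bcost more_vertices + max_cost output_body))))))))
      (\<lambda>s'. \<exists>T\<subseteq>{..n}. output_vec n s' = indicator_vec n T \<and> optimal T)"
    unfolding min_cut_program_def
  proof (rule runs_within_Seq[OF start], goal_cases)
    case (1 s1)
    show ?case
    proof (rule runs_within_Seq)
      show "runs_within (While more_vertices init_body) s1
          (N * (1 + bcost more_vertices + max_cost init_body))
          (\<lambda>s'. init_inv n q p s' \<and> \<not> bval more_vertices s')"
        using 1 init_body_step
        by (intro runs_within_While[where
              \<mu> = "\<lambda>s. (n + 1 - nats s ''i'' []) * (n + 2) + (n + 1 - nats s ''j'' [])"])
          (simp add: init_body_def, blast+)
    qed (elim conjE, rule flow, assumption+)
  qed
  have cost: "max_cost init_start + (N * (1 + bcost more_vertices + max_cost init_body) +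
      (max_cost flow_start + (4 * N * (1 + bcost more_levels + max_cost flow_body) +
        (max_cost gap_start + (N * (1 + bcost more_vertices + max_cost gap_body) +
        (max_cost output_start + N * (1 + bcost more_vertices + max_cost output_body))))))) \<le>
      program_const * N"
  proof -
    have le: "k \<le> k * N" for k :: nat
      using N(2) by simp
    have "a + (N * k1 + (b + (4 * N * k2 + (c + (N * k3 + (d + N * k4)))))) \<le>
        (a + k1 + b + 4 * k2 + c + k3 + d + k4) * N" for a b c d k1 k2 k3 k4
      using add_mono[OF le[of a] add_mono[OF le[of b] add_mono[OF le[of c] le[of d]]]]
      by (simp add: algebra_simps)
    then show ?thesis unfolding program_const_def .
  qed
  have "runs_within min_cut_program s (program_const * N)
      (\<lambda>s'. \<exists>T\<subseteq>{..n}. output_vec n s' = indicator_vec n T \<and> optimal T)"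
    by (rule runs_within_weaken[OF total cost])
  then show ?thesis unfolding N_def optimal_def .
qed

text \<open>From \<open>n + 2 <= 3 * n\<close> for \<open>n >= 1\<close>, whence the factor
  27.\<close>

lemma cubic_bigo: "(\<lambda>n. real (K * (n + 2) ^ 3)) \<in> O(\<lambda>n. real n ^ 3)"
proof (rule bigoI)
  show "eventually (\<lambda>n. norm (real (K * (n + 2) ^ 3)) \<le> real K * 27 * norm (real n ^ 3)) sequentially"
  proof (rule eventually_sequentiallyI[of 1])
    fix n :: nat assume "1 \<le> n"
    then have "real (n + 2) ^ 3 \<le> (3 * real n) ^ 3" by (intro power_mono) auto
    then have "real K * real (n + 2) ^ 3 \<le> real K * (3 * real n) ^ 3" by (intro mult_left_mono) auto
    then show "norm (real (K * (n + 2) ^ 3)) \<le> real K * 27 * norm (real n ^ 3)"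
      by (simp add: power_mult_distrib)
  qed
qed

theorem mainTheorem3:
  shows
    "(\<forall>m n \<Lambda> b p.
        is_lattice m n \<Lambda> \<longrightarrow> obtuse_superbasis m n \<Lambda> b \<longrightarrow> p \<in> carrier_vec (n + 1) \<longrightarrow>
        (let B = mat_of_cols m b; V = {0..n + 2}; w = network_weight n (gram b) p in
          undirected_flow_network V w 0 (n + 2) \<and>
          (\<forall>C. is_cut V 0 (n + 2) C \<longrightarrow>
             (is_min_cut V w 0 (n + 2) C \<longleftrightarrow> minimises_dist B p (cut_vec n C)))))
     \<and>
     (\<exists>(prog :: com) (T :: nat \<Rightarrow> nat).
        (\<lambda>n. real (T n)) \<in> O(\<lambda>n. real n ^ 3) \<and>
        (\<forall>m n \<Lambda> b p s.
           is_lattice m n \<Lambda> \<longrightarrow> obtuse_superbasis m n \<Lambda> b \<longrightarrow> p \<in> carrier_vec (n + 1) \<longrightarrow>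
           input_stored n (gram b) p s \<longrightarrow>
           (\<exists>k s'. exec prog s k s' \<and> k \<le> T n \<and>
              minimises_dist (mat_of_cols m b) p (output_vec n s'))))"
proof (intro conjI)
  show "\<forall>m n \<Lambda> b p.
      is_lattice m n \<Lambda> \<longrightarrow> obtuse_superbasis m n \<Lambda> b \<longrightarrow> p \<in> carrier_vec (n + 1) \<longrightarrow>
      (let B = mat_of_cols m b; V = {0..n + 2}; w = network_weight n (gram b) p in
        undirected_flow_network V w 0 (n + 2) \<and>
        (\<forall>C. is_cut V 0 (n + 2) C \<longrightarrow>
           (is_min_cut V w 0 (n + 2) C \<longleftrightarrow> minimises_dist B p (cut_vec n C))))"
    unfolding Let_def using network_undirected min_cut_iff_minimises_dist by blast
next
  have "\<exists>k s'. exec min_cut_program s k s' \<and> k \<le> program_const * (n + 2) ^ 3 \<and>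
      minimises_dist (mat_of_cols m b) p (output_vec n s')"
    if sb: "obtuse_superbasis m n \<Lambda> b" and p: "p \<in> carrier_vec (n + 1)"
      and input: "input_stored n (gram b) p s" for m n \<Lambda> b p s
  proof -
    have b: "length b = n + 1" "set b \<subseteq> carrier_vec m"
      using sb by (auto simp: obtuse_superbasis_def)
    have "gram b i j \<le> 0" if "i \<le> n" "j \<le> n" "i \<noteq> j" for i j
      using sb that by (simp add: obtuse_superbasis_def gram_def)
    then have "runs_within min_cut_program s (program_const * (n + 2) ^ 3)
        (\<lambda>s'. \<exists>T\<subseteq>{..n}. output_vec n s' = indicator_vec n T \<and>
           (\<forall>T'\<subseteq>{..n}. set_objective (gram b) (\<lambda>a. 2 * (\<Sum>c\<le>n. gram b a c * p $ c)) T \<le>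
              set_objective (gram b) (\<lambda>a. 2 * (\<Sum>c\<le>n. gram b a c * p $ c)) T'))"
      using min_cut_program_correct[OF input] superbasis_row_sum[OF sb] by blast
    then have "runs_within min_cut_program s (program_const * (n + 2) ^ 3)
        (\<lambda>s'. minimises_dist (mat_of_cols m b) p (output_vec n s'))"
    proof (rule runs_within_weaken)
      fix s'
      assume "\<exists>T\<subseteq>{..n}. output_vec n s' = indicator_vec n T \<and>
         (\<forall>T'\<subseteq>{..n}. set_objective (gram b) (\<lambda>a. 2 * (\<Sum>c\<le>n. gram b a c * p $ c)) T \<le>
            set_objective (gram b) (\<lambda>a. 2 * (\<Sum>c\<le>n. gram b a c * p $ c)) T')"
      \<comment> \<open>The program's initial excess is minus the terminal weight.\<close>
      then show "minimises_dist (mat_of_cols m b) p (output_vec n s')"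
        using minimises_dist_indicator[OF b p] by (auto simp: terminal_weight_def)
    qed simp
    then show ?thesis unfolding runs_within_def .
  qed
  then show "\<exists>(prog :: com) (T :: nat \<Rightarrow> nat).
      (\<lambda>n. real (T n)) \<in> O(\<lambda>n. real n ^ 3) \<and>
      (\<forall>m n \<Lambda> b p s.
         is_lattice m n \<Lambda> \<longrightarrow> obtuse_superbasis m n \<Lambda> b \<longrightarrow> p \<in> carrier_vec (n + 1) \<longrightarrow>
         input_stored n (gram b) p s \<longrightarrow>
         (\<exists>k s'. exec prog s k s' \<and> k \<le> T n \<and>
            minimises_dist (mat_of_cols m b) p (output_vec n s')))"
    using cubic_bigo[of program_const]
    by (intro exI[of _ min_cut_program] exI[of _ "\<lambda>n. program_const * (n + 2) ^ 3"]) blast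
qed

end
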